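(* Let $R$ be a ring, let $M$ be a left $R$-module, and let $X\in\sigma[M]$ have a projective cover $P$ in $\sigma[M]$. Denote by $\pi:P\rightarrow X$ the projection and put $T:=\mathrm{Tr}(P,\mathrm{Ker}(\pi))$. Then $\widetilde{P}=P/T$, together with the epimorphism $\widetilde{\pi}:\widetilde{P}\rightarrow X$ induced by $\pi$, is a maximal codense cover of $X$ in $\sigma[M]$.
   Context: Rings are associative with unit. $\sigma[M]$ is the full subcategory of left $R$-modules consisting of all submodules of factor modules of direct sums of copies of $M$. A submodule $N\subseteq Y$ is small ($N\ll Y$) if $N+L\neq Y$ for every proper submodule $L$ of $Y$. A projective cover of $X$ in $\sigma[M]$ is a projective object $P$ of $\sigma[M]$ with an epimorphism $\pi:P\to X$ such that $\mathrm{Ker}(\pi)\ll P$. For modules $U,V$ the trace is $\mathrm{Tr}(U,V)=\sum\{\mathrm{Im}(f)\mid f\in\mathrm{Hom}(U,V)\}$. A cover of $X$ is a module $Y$ with an epimorphism $\pi:Y\to X$; it is a codense cover if $\mathrm{Hom}(Y,\mathrm{Ker}(\pi)/L)=0$ for all submodules $L\subseteq\mathrm{Ker}(\pi)$. For $X,Y\in\sigma[M]$, a codense cover $p:Y\to X$ is a maximal codense cover in $\sigma[M]$ if for every codense cover $\pi':Z\to X$ with $Z\in\sigma[M]$ there exists a unique epimorphism $\psi:Y\to Z$ with $\pi'\circ\psi=p$. *)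

theory Defs
  imports "HOL-Algebra.AbelCoset" "HOL-Algebra.Module" "HOL-Library.Countable_Set"
begin

section \<open>Left modules\<close>

text \<open>
  The locale \<^locale>\<open>module\<close> of HOL-Algebra demands a commutative ring of scalars; the axioms below
  are the same, over an arbitrary ring. The locale \<^locale>\<open>submodule\<close> does not involve commutativity
  and is used as it is. In the record type \<^typ>\<open>('r, 'a) module\<close> the ring-multiplicative fields
  \<^const>\<open>mult\<close> and \<^const>\<open>one\<close> carry no meaning.
\<close>

locale left_module = R?: ring R + M?: abelian_group M
  for R :: "('r, 's) ring_scheme" (structure) and M :: "('r, 'a, 't) module_scheme" (structure) +
  assumes smult_closed [simp, intro]:
      "\<lbrakk>a \<in> carrier R; x \<in> carrier M\<rbrakk> \<Longrightarrow> a \<odot>\<^bsub>M\<^esub> x \<in> carrier M"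
    and smult_l_distr:
      "\<lbrakk>a \<in> carrier R; b \<in> carrier R; x \<in> carrier M\<rbrakk> \<Longrightarrow>
        (a \<oplus> b) \<odot>\<^bsub>M\<^esub> x = a \<odot>\<^bsub>M\<^esub> x \<oplus>\<^bsub>M\<^esub> b \<odot>\<^bsub>M\<^esub> x"
    and smult_r_distr:
      "\<lbrakk>a \<in> carrier R; x \<in> carrier M; y \<in> carrier M\<rbrakk> \<Longrightarrow>
        a \<odot>\<^bsub>M\<^esub> (x \<oplus>\<^bsub>M\<^esub> y) = a \<odot>\<^bsub>M\<^esub> x \<oplus>\<^bsub>M\<^esub> a \<odot>\<^bsub>M\<^esub> y"
    and smult_assoc1:
      "\<lbrakk>a \<in> carrier R; b \<in> carrier R; x \<in> carrier M\<rbrakk> \<Longrightarrow>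
        (a \<otimes> b) \<odot>\<^bsub>M\<^esub> x = a \<odot>\<^bsub>M\<^esub> (b \<odot>\<^bsub>M\<^esub> x)"
    and smult_one [simp]:
      "x \<in> carrier M \<Longrightarrow> \<one> \<odot>\<^bsub>M\<^esub> x = x"

definition lmod_hom :: "'r ring \<Rightarrow> ('r, 'a) module \<Rightarrow> ('r, 'b) module \<Rightarrow> ('a \<Rightarrow> 'b) set" where
  "lmod_hom R U V =
    {f \<in> carrier U \<rightarrow> carrier V.
      (\<forall>x\<in>carrier U. \<forall>y\<in>carrier U. f (x \<oplus>\<^bsub>U\<^esub> y) = f x \<oplus>\<^bsub>V\<^esub> f y) \<and>
      (\<forall>r\<in>carrier R. \<forall>x\<in>carrier U. f (r \<odot>\<^bsub>U\<^esub> x) = r \<odot>\<^bsub>V\<^esub> f x)}"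

definition lmod_epi :: "'r ring \<Rightarrow> ('r, 'a) module \<Rightarrow> ('r, 'b) module \<Rightarrow> ('a \<Rightarrow> 'b) set" where
  "lmod_epi R U V = {f \<in> lmod_hom R U V. f ` carrier U = carrier V}"

text \<open>A submodule \<open>N\<close> of \<open>U\<close>, regarded as a module, is \<open>U\<lparr>carrier := N\<rparr>\<close>.\<close>

definition quotient_lmod :: "('r, 'a, 't) module_scheme \<Rightarrow> 'a set \<Rightarrow> ('r, 'a set) module" where
  "quotient_lmod U N =
    \<lparr>carrier = a_rcosets\<^bsub>U\<^esub> N, mult = (\<lambda>_ _. N), one = N, zero = N, add = (<+>\<^bsub>U\<^esub>),
     smult = (\<lambda>r C. \<Union>c\<in>C. N +>\<^bsub>U\<^esub> (r \<odot>\<^bsub>U\<^esub> c))\<rparr>"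

definition small_submodule :: "'r ring \<Rightarrow> 'a set \<Rightarrow> ('r, 'a) module \<Rightarrow> bool" where
  "small_submodule R N Y \<longleftrightarrow>
    submodule N R Y \<and>
    (\<forall>L. submodule L R Y \<and> L \<noteq> carrier Y \<longrightarrow> N <+>\<^bsub>Y\<^esub> L \<noteq> carrier Y)"

text \<open>The sum of a family of submodules consists of the finite sums of elements of its members.\<close>

definition sum_of_submodules :: "('r, 'a) module \<Rightarrow> 'a set set \<Rightarrow> 'a set" where
  "sum_of_submodules V \<N> =
    {finsum V g \<F> | g \<F>. finite \<F> \<and> \<F> \<subseteq> \<N> \<and> (\<forall>N\<in>\<F>. g N \<in> N)}"

definition lmod_trace :: "'r ring \<Rightarrow> ('r, 'a) module \<Rightarrow> ('r, 'b) module \<Rightarrow> 'b set" where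
  "lmod_trace R U V = sum_of_submodules V {f ` carrier U | f. f \<in> lmod_hom R U V}"


section \<open>The category \<open>\<sigma>[M]\<close>\<close>

text \<open>Direct sum of copies of \<open>M\<close> indexed by \<open>I\<close>; its elements are extended by zero outside \<open>I\<close>.\<close>

definition direct_sum_copies :: "'i set \<Rightarrow> ('r, 'm) module \<Rightarrow> ('r, 'i \<Rightarrow> 'm) module" where
  "direct_sum_copies I M =
    \<lparr>carrier = {x. (\<forall>i. x i \<in> carrier M) \<and> {i. x i \<noteq> \<zero>\<^bsub>M\<^esub>} \<subseteq> I \<and> finite {i. x i \<noteq> \<zero>\<^bsub>M\<^esub>}},
     mult = (\<lambda>_ _ _. \<zero>\<^bsub>M\<^esub>), one = (\<lambda>_. \<zero>\<^bsub>M\<^esub>), zero = (\<lambda>_. \<zero>\<^bsub>M\<^esub>),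
     add = (\<lambda>x y i. x i \<oplus>\<^bsub>M\<^esub> y i), smult = (\<lambda>r x i. r \<odot>\<^bsub>M\<^esub> x i)\<rparr>"

text \<open>
  \<open>N\<close> is, up to isomorphism, a submodule of a factor module of a direct sum of copies of \<open>M\<close>.
  A bound variable cannot range over index sets of all types, so the type of indices is a parameter.
  In \<open>in_sigma\<close> it is fixed to a type that depends on that of \<open>N\<close> only; no generality is lost,
  as shown by lemma \<open>in_sigma_any_index\<close> below.
\<close>

definition in_sigma_idx :: "'i itself \<Rightarrow> 'r ring \<Rightarrow> ('r, 'm) module \<Rightarrow> ('r, 'n) module \<Rightarrow> bool" where
  "in_sigma_idx (_ :: 'i itself) R M N \<longleftrightarrow>
    left_module R N \<and>
    (\<exists>(I :: 'i set) K h.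
      submodule K R (direct_sum_copies I M) \<and>
      h \<in> lmod_hom R N (quotient_lmod (direct_sum_copies I M) K) \<and>
      inj_on h (carrier N))"

definition in_sigma :: "'r ring \<Rightarrow> ('r, 'm) module \<Rightarrow> ('r, 'n) module \<Rightarrow> bool" where
  "in_sigma R M N \<longleftrightarrow> in_sigma_idx TYPE('n \<times> nat) R M N"

text \<open>
  Projectivity in \<open>\<sigma>[M]\<close>, tested on epimorphisms \<open>A \<rightarrow> B\<close> between modules with carriers in two given
  types. In \<open>projective_in_sigma\<close> these are types that are large enough to give the lifting property
  for modules \<open>A\<close> and \<open>B\<close> in arbitrary types: see lemma \<open>projective_in_sigma_any_type\<close> below.
\<close>

definition projective_in_sigma_wrt ::
  "'a itself \<Rightarrow> 'b itself \<Rightarrow> 'r ring \<Rightarrow> ('r, 'm) module \<Rightarrow> ('r, 'p) module \<Rightarrow> bool" where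
  "projective_in_sigma_wrt (_ :: 'a itself) (_ :: 'b itself) R M P \<longleftrightarrow>
    in_sigma R M P \<and>
    (\<forall>(A :: ('r, 'a) module) (B :: ('r, 'b) module) g f.
      in_sigma R M A \<and> in_sigma R M B \<and> g \<in> lmod_epi R A B \<and> f \<in> lmod_hom R P B \<longrightarrow>
      (\<exists>h\<in>lmod_hom R P A. \<forall>x\<in>carrier P. g (h x) = f x))"

definition projective_in_sigma :: "'r ring \<Rightarrow> ('r, 'm) module \<Rightarrow> ('r, 'p) module \<Rightarrow> bool" where
  "projective_in_sigma R M P \<longleftrightarrow>
    projective_in_sigma_wrt TYPE(('r \<times> 'p) list) TYPE('p) R M P"

definition projective_cover ::
  "'r ring \<Rightarrow> ('r, 'm) module \<Rightarrow> ('r, 'x) module \<Rightarrow> ('r, 'p) module \<Rightarrow> ('p \<Rightarrow> 'x) \<Rightarrow> bool" where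
  "projective_cover R M X P \<pi> \<longleftrightarrow>
    projective_in_sigma R M P \<and> \<pi> \<in> lmod_epi R P X \<and> small_submodule R (a_kernel P X \<pi>) P"


section \<open>Codense covers\<close>

definition codense_cover ::
  "'r ring \<Rightarrow> ('r, 'x) module \<Rightarrow> ('r, 'y) module \<Rightarrow> ('y \<Rightarrow> 'x) \<Rightarrow> bool" where
  "codense_cover R X Y p \<longleftrightarrow>
    left_module R Y \<and> p \<in> lmod_epi R Y X \<and>
    (\<forall>L. submodule L R (Y\<lparr>carrier := a_kernel Y X p\<rparr>) \<longrightarrow>
      (\<forall>f \<in> lmod_hom R Y (quotient_lmod (Y\<lparr>carrier := a_kernel Y X p\<rparr>) L).
        \<forall>y\<in>carrier Y. f y = \<zero>\<^bsub>quotient_lmod (Y\<lparr>carrier := a_kernel Y X p\<rparr>) L\<^esub>))"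

text \<open>
  The codense covers \<open>Z\<close> that are compared with \<open>Y\<close> range over all modules with carrier in the type
  \<open>'z\<close>; a theorem in which \<open>'z\<close> is a free type variable covers all of them.
\<close>

definition maximal_codense_cover ::
  "'z itself \<Rightarrow> 'r ring \<Rightarrow> ('r, 'm) module \<Rightarrow> ('r, 'x) module \<Rightarrow> ('r, 'y) module \<Rightarrow>
    ('y \<Rightarrow> 'x) \<Rightarrow> bool" where
  "maximal_codense_cover (_ :: 'z itself) R M X Y p \<longleftrightarrow>
    in_sigma R M X \<and> in_sigma R M Y \<and> codense_cover R X Y p \<and>
    (\<forall>(Z :: ('r, 'z) module) q. in_sigma R M Z \<and> codense_cover R X Z q \<longrightarrow>
      (\<exists>\<psi>\<in>lmod_epi R Y Z. (\<forall>y\<in>carrier Y. q (\<psi> y) = p y) \<and>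
        (\<forall>\<psi>'\<in>lmod_epi R Y Z. (\<forall>y\<in>carrier Y. q (\<psi>' y) = p y) \<longrightarrow>
          (\<forall>y\<in>carrier Y. \<psi>' y = \<psi> y))))"

text \<open>The map on cosets induced by a map that is constant on each of them.\<close>

definition induced_map :: "('a \<Rightarrow> 'b) \<Rightarrow> 'a set \<Rightarrow> 'b" where
  "induced_map f C = the_elem (f ` C)"

section \<open>Independence of the choice of types\<close>

subsection \<open>Auxiliary facts on left modules\<close>

lemma lmod_homI:
  assumes "\<And>x. x \<in> carrier U \<Longrightarrow> f x \<in> carrier V"
    and "\<And>x y. \<lbrakk>x \<in> carrier U; y \<in> carrier U\<rbrakk> \<Longrightarrow> f (x \<oplus>\<^bsub>U\<^esub> y) = f x \<oplus>\<^bsub>V\<^esub> f y"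
    and "\<And>r x. \<lbrakk>r \<in> carrier R; x \<in> carrier U\<rbrakk> \<Longrightarrow> f (r \<odot>\<^bsub>U\<^esub> x) = r \<odot>\<^bsub>V\<^esub> f x"
  shows "f \<in> lmod_hom R U V"
  using assms by (auto simp: lmod_hom_def)

lemma lmod_homD:
  assumes "f \<in> lmod_hom R U V"
  shows "x \<in> carrier U \<Longrightarrow> f x \<in> carrier V"
    and "\<lbrakk>x \<in> carrier U; y \<in> carrier U\<rbrakk> \<Longrightarrow> f (x \<oplus>\<^bsub>U\<^esub> y) = f x \<oplus>\<^bsub>V\<^esub> f y"
    and "\<lbrakk>r \<in> carrier R; x \<in> carrier U\<rbrakk> \<Longrightarrow> f (r \<odot>\<^bsub>U\<^esub> x) = r \<odot>\<^bsub>V\<^esub> f x"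
  using assms by (auto simp: lmod_hom_def)

lemma lmod_hom_comp:
  assumes "f \<in> lmod_hom R U V" "g \<in> lmod_hom R V W"
  shows "(\<lambda>x. g (f x)) \<in> lmod_hom R U W"
  using assms by (intro lmod_homI) (simp_all add: lmod_homD)

context left_module
begin

lemma smult_l_null [simp]:
  assumes "x \<in> carrier M" shows "\<zero> \<odot>\<^bsub>M\<^esub> x = \<zero>\<^bsub>M\<^esub>"
proof -
  have "\<zero> \<odot>\<^bsub>M\<^esub> x \<oplus>\<^bsub>M\<^esub> \<zero> \<odot>\<^bsub>M\<^esub> x = \<zero> \<odot>\<^bsub>M\<^esub> x"
    using assms smult_l_distr[of \<zero> \<zero> x] by simp
  then show ?thesis using assms by (metis M.add.r_cancel_one' R.zero_closed smult_closed)
qed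

lemma smult_r_null [simp]:
  assumes "a \<in> carrier R" shows "a \<odot>\<^bsub>M\<^esub> \<zero>\<^bsub>M\<^esub> = \<zero>\<^bsub>M\<^esub>"
proof -
  have "a \<odot>\<^bsub>M\<^esub> \<zero>\<^bsub>M\<^esub> \<oplus>\<^bsub>M\<^esub> a \<odot>\<^bsub>M\<^esub> \<zero>\<^bsub>M\<^esub> = a \<odot>\<^bsub>M\<^esub> \<zero>\<^bsub>M\<^esub>"
    using assms smult_r_distr[of a "\<zero>\<^bsub>M\<^esub>" "\<zero>\<^bsub>M\<^esub>"] by simp
  then show ?thesis using assms by (metis M.add.r_cancel_one' M.zero_closed smult_closed)
qed

lemma smult_l_minus_one:
  assumes "x \<in> carrier M" shows "(\<ominus> \<one>) \<odot>\<^bsub>M\<^esub> x = \<ominus>\<^bsub>M\<^esub> x"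
proof -
  have "(\<ominus> \<one>) \<odot>\<^bsub>M\<^esub> x \<oplus>\<^bsub>M\<^esub> x = \<zero>\<^bsub>M\<^esub>"
    using assms smult_l_distr[of "\<ominus> \<one>" \<one> x] by (simp add: R.l_neg)
  then show ?thesis using assms by (simp add: M.minus_equality)
qed

lemma submodule_smultI:
  assumes "H \<subseteq> carrier M" "\<zero>\<^bsub>M\<^esub> \<in> H"
    and "\<And>a b. \<lbrakk>a \<in> H; b \<in> H\<rbrakk> \<Longrightarrow> a \<oplus>\<^bsub>M\<^esub> b \<in> H"
    and "\<And>a x. \<lbrakk>a \<in> carrier R; x \<in> H\<rbrakk> \<Longrightarrow> a \<odot>\<^bsub>M\<^esub> x \<in> H"
  shows "submodule H R M"
proof -
  have "\<ominus>\<^bsub>M\<^esub> x \<in> H" if "x \<in> H" for x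
    using assms(1) assms(4)[of "\<ominus> \<one>" x] that smult_l_minus_one[of x] by auto
  then show ?thesis
    using assms by (intro submodule.intro subgroup.intro submodule_axioms.intro)
      (auto simp: a_inv_def[symmetric])
qed

lemma submoduleD:
  assumes "submodule H R M"
  shows "H \<subseteq> carrier M" "\<zero>\<^bsub>M\<^esub> \<in> H"
    and "\<lbrakk>x \<in> H; y \<in> H\<rbrakk> \<Longrightarrow> x \<oplus>\<^bsub>M\<^esub> y \<in> H"
    and "x \<in> H \<Longrightarrow> \<ominus>\<^bsub>M\<^esub> x \<in> H"
    and "\<lbrakk>a \<in> carrier R; x \<in> H\<rbrakk> \<Longrightarrow> a \<odot>\<^bsub>M\<^esub> x \<in> H"
proof -
  interpret H: submodule H R M by fact
  show "H \<subseteq> carrier M" "\<zero>\<^bsub>M\<^esub> \<in> H" "\<lbrakk>x \<in> H; y \<in> H\<rbrakk> \<Longrightarrow> x \<oplus>\<^bsub>M\<^esub> y \<in> H"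
    "x \<in> H \<Longrightarrow> \<ominus>\<^bsub>M\<^esub> x \<in> H" "\<lbrakk>a \<in> carrier R; x \<in> H\<rbrakk> \<Longrightarrow> a \<odot>\<^bsub>M\<^esub> x \<in> H"
    using H.subset H.one_closed H.m_closed H.m_inv_closed by (auto simp: a_inv_def)
qed

lemma submodule_abelian_subgroup:
  "submodule H R M \<Longrightarrow> abelian_subgroup H M"
  using M.abelian_group_axioms abelian_subgroupI3 additive_subgroupI submodule.axioms(1) by blast

lemma submodule_left_module:
  assumes "submodule H R M"
  shows "left_module R (M\<lparr>carrier := H\<rparr>)"
proof -
  note D = submoduleD[OF assms]
  have sub: "x \<in> carrier M" if "x \<in> H" for x using D(1) that by auto
  show ?thesis
  proof (intro left_module.intro left_module_axioms.intro)
    show "ring R" by (rule R.ring_axioms)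
    show "abelian_group (M\<lparr>carrier := H\<rparr>)"
    proof (rule abelian_groupI)
      fix x assume "x \<in> carrier (M\<lparr>carrier := H\<rparr>)"
      then show "\<exists>y\<in>carrier (M\<lparr>carrier := H\<rparr>).
          y \<oplus>\<^bsub>M\<lparr>carrier := H\<rparr>\<^esub> x = \<zero>\<^bsub>M\<lparr>carrier := H\<rparr>\<^esub>"
        using D(4) sub by (auto intro!: bexI[of _ "\<ominus>\<^bsub>M\<^esub> x"] simp: M.l_neg)
    qed (use D sub in \<open>auto simp: M.a_ac\<close>)
  qed (use D sub in \<open>auto simp: smult_l_distr smult_r_distr smult_assoc1\<close>)
qed

lemma coset_eq_iff:
  assumes "submodule H R M" "x \<in> carrier M" "y \<in> carrier M"
  shows "H +>\<^bsub>M\<^esub> x = H +>\<^bsub>M\<^esub> y \<longleftrightarrow> x \<oplus>\<^bsub>M\<^esub> (\<ominus>\<^bsub>M\<^esub> y) \<in> H"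
proof -
  interpret H: abelian_subgroup H M by (rule submodule_abelian_subgroup) fact
  have "H +>\<^bsub>M\<^esub> x = H +>\<^bsub>M\<^esub> y \<longleftrightarrow> x \<in> H +>\<^bsub>M\<^esub> y"
    using H.a_rcos_self[OF assms(2)] H.a_repr_independence'[of x y, OF _ assms(3)] by auto
  then show ?thesis using H.a_rcos_module[OF assms(3,2)] by simp
qed

lemma quotient_smult:
  assumes H: "submodule H R M" and r: "r \<in> carrier R" and x: "x \<in> carrier M"
  shows "r \<odot>\<^bsub>quotient_lmod M H\<^esub> (H +>\<^bsub>M\<^esub> x) = H +>\<^bsub>M\<^esub> (r \<odot>\<^bsub>M\<^esub> x)"
proof -
  interpret H: abelian_subgroup H M by (rule submodule_abelian_subgroup) fact
  have "H +>\<^bsub>M\<^esub> (r \<odot>\<^bsub>M\<^esub> c) = H +>\<^bsub>M\<^esub> (r \<odot>\<^bsub>M\<^esub> x)" if c: "c \<in> H +>\<^bsub>M\<^esub> x" for c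
  proof -
    obtain k where k: "k \<in> H" "c = k \<oplus>\<^bsub>M\<^esub> x" using c by (auto simp: a_r_coset_def')
    have kM: "k \<in> carrier M" using k submoduleD(1)[OF H] by auto
    have cM: "c \<in> carrier M" using k kM x by simp
    have "r \<odot>\<^bsub>M\<^esub> c \<oplus>\<^bsub>M\<^esub> (\<ominus>\<^bsub>M\<^esub> (r \<odot>\<^bsub>M\<^esub> x)) = r \<odot>\<^bsub>M\<^esub> k"
      using k kM r x by (simp add: smult_r_distr M.a_assoc M.r_neg)
    then show ?thesis
      using coset_eq_iff[OF H, of "r \<odot>\<^bsub>M\<^esub> c" "r \<odot>\<^bsub>M\<^esub> x"] submoduleD(5)[OF H r k(1)]
        cM r x by simp
  qed
  moreover have "x \<in> H +>\<^bsub>M\<^esub> x" using x by (rule H.a_rcos_self)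
  ultimately have "(\<Union>c\<in>H +>\<^bsub>M\<^esub> x. H +>\<^bsub>M\<^esub> (r \<odot>\<^bsub>M\<^esub> c)) = H +>\<^bsub>M\<^esub> (r \<odot>\<^bsub>M\<^esub> x)"
    by (intro UN_constant_eq ballI)
  then show ?thesis by (simp add: quotient_lmod_def)
qed

lemma quotient_add:
  assumes "submodule H R M" "x \<in> carrier M" "y \<in> carrier M"
  shows "(H +>\<^bsub>M\<^esub> x) \<oplus>\<^bsub>quotient_lmod M H\<^esub> (H +>\<^bsub>M\<^esub> y) = H +>\<^bsub>M\<^esub> (x \<oplus>\<^bsub>M\<^esub> y)"
  using abelian_subgroup.a_rcos_sum[OF submodule_abelian_subgroup[OF assms(1)] assms(2,3)]
  by (simp add: quotient_lmod_def)

lemma quotient_carrier: "carrier (quotient_lmod M H) = {H +>\<^bsub>M\<^esub> x | x. x \<in> carrier M}"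
  by (auto simp: quotient_lmod_def A_RCOSETS_def')

end

lemma lmod_hom_minus:
  assumes "left_module R U" "left_module R V" "f \<in> lmod_hom R U V" "x \<in> carrier U"
  shows "f (\<ominus>\<^bsub>U\<^esub> x) = \<ominus>\<^bsub>V\<^esub> f x"
proof -
  interpret U: left_module R U by fact
  interpret V: left_module R V by fact
  show ?thesis
    using U.smult_l_minus_one[OF assms(4)] V.smult_l_minus_one[OF lmod_homD(1)[OF assms(3,4)]]
      lmod_homD(3)[OF assms(3) _ assms(4), of "\<ominus>\<^bsub>R\<^esub> \<one>\<^bsub>R\<^esub>"] by simp
qed

lemma lmod_hom_zero:
  assumes "left_module R U" "left_module R V" "f \<in> lmod_hom R U V"
  shows "f \<zero>\<^bsub>U\<^esub> = \<zero>\<^bsub>V\<^esub>"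
proof -
  interpret U: left_module R U by fact
  interpret V: left_module R V by fact
  show ?thesis
    using U.smult_l_null[of "\<zero>\<^bsub>U\<^esub>"] V.smult_l_null[of "f \<zero>\<^bsub>U\<^esub>"]
      lmod_homD(1)[OF assms(3), of "\<zero>\<^bsub>U\<^esub>"] lmod_homD(3)[OF assms(3), of "\<zero>\<^bsub>R\<^esub>" "\<zero>\<^bsub>U\<^esub>"] by simp
qed

lemma submodule_vimage:
  assumes "left_module R U" "left_module R V" "f \<in> lmod_hom R U V" "submodule K R V"
  shows "submodule {x \<in> carrier U. f x \<in> K} R U"
proof -
  interpret U: left_module R U by fact
  interpret V: left_module R V by fact
  show ?thesis
    using V.submoduleD[OF assms(4)] lmod_homD[OF assms(3)] lmod_hom_zero[OF assms(1-3)]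
    by (intro U.submodule_smultI) auto
qed

lemma submodule_image:
  assumes "left_module R U" "left_module R V" "f \<in> lmod_hom R U V"
  shows "submodule (f ` carrier U) R V"
proof -
  interpret U: left_module R U by fact
  interpret V: left_module R V by fact
  show ?thesis
  proof (rule V.submodule_smultI)
    show "\<zero>\<^bsub>V\<^esub> \<in> f ` carrier U"
      using lmod_hom_zero[OF assms] U.zero_closed by (metis imageI)
    show "a \<oplus>\<^bsub>V\<^esub> b \<in> f ` carrier U" if "a \<in> f ` carrier U" "b \<in> f ` carrier U" for a b
      using that by (auto simp: lmod_homD(2)[OF assms(3), symmetric])
    show "a \<odot>\<^bsub>V\<^esub> x \<in> f ` carrier U" if "a \<in> carrier R" "x \<in> f ` carrier U" for a x
      using that by (auto simp: lmod_homD(3)[OF assms(3), symmetric])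
  qed (use lmod_homD(1)[OF assms(3)] in auto)
qed

lemma direct_sum_left_module:
  assumes "left_module R M"
  shows "left_module R (direct_sum_copies I M)"
proof -
  interpret left_module R M by fact
  let ?D = "direct_sum_copies I M"
  let ?supp = "\<lambda>x. {i. x i \<noteq> \<zero>\<^bsub>M\<^esub>}"
  have mem: "x \<in> carrier ?D \<longleftrightarrow> (\<forall>i. x i \<in> carrier M) \<and> ?supp x \<subseteq> I \<and> finite (?supp x)" for x
    by (simp add: direct_sum_copies_def)
  have add: "(\<lambda>i. x i \<oplus>\<^bsub>M\<^esub> y i) \<in> carrier ?D" if "x \<in> carrier ?D" "y \<in> carrier ?D" for x y
  proof -
    have "?supp (\<lambda>i. x i \<oplus>\<^bsub>M\<^esub> y i) \<subseteq> ?supp x \<union> ?supp y" by auto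
    then show ?thesis using that unfolding mem by (metis (no_types, lifting) M.a_closed finite_Un
          finite_subset le_sup_iff subset_trans)
  qed
  have smult: "(\<lambda>i. r \<odot>\<^bsub>M\<^esub> x i) \<in> carrier ?D" if "r \<in> carrier R" "x \<in> carrier ?D" for r x
  proof -
    have "?supp (\<lambda>i. r \<odot>\<^bsub>M\<^esub> x i) \<subseteq> ?supp x" using that(1) by auto
    then show ?thesis using that unfolding mem by (metis (no_types, lifting) smult_closed
          finite_subset subset_trans)
  qed
  have inM: "x i \<in> carrier M" if "x \<in> carrier ?D" for x i using that by (simp add: mem)
  have [simp]: "x \<oplus>\<^bsub>?D\<^esub> y = (\<lambda>i. x i \<oplus>\<^bsub>M\<^esub> y i)" "r \<odot>\<^bsub>?D\<^esub> x = (\<lambda>i. r \<odot>\<^bsub>M\<^esub> x i)"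
    "\<zero>\<^bsub>?D\<^esub> = (\<lambda>_. \<zero>\<^bsub>M\<^esub>)" for x y r by (simp_all add: direct_sum_copies_def)
  show ?thesis
  proof (intro left_module.intro left_module_axioms.intro)
    show "ring R" by (rule R.ring_axioms)
    show "abelian_group ?D"
    proof (rule abelian_groupI)
      fix x assume x: "x \<in> carrier ?D"
      then have "(\<lambda>i. (\<ominus>\<^bsub>R\<^esub> \<one>\<^bsub>R\<^esub>) \<odot>\<^bsub>M\<^esub> x i) \<in> carrier ?D" by (intro smult) auto
      moreover have "(\<lambda>i. (\<ominus>\<^bsub>R\<^esub> \<one>\<^bsub>R\<^esub>) \<odot>\<^bsub>M\<^esub> x i) \<oplus>\<^bsub>?D\<^esub> x = \<zero>\<^bsub>?D\<^esub>"
        using inM[OF x] by (simp add: smult_l_minus_one M.l_neg)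
      ultimately show "\<exists>y\<in>carrier ?D. y \<oplus>\<^bsub>?D\<^esub> x = \<zero>\<^bsub>?D\<^esub>" by blast
    qed (use add inM in \<open>auto simp: M.a_ac mem\<close>)
  qed (use smult inM in \<open>auto simp: smult_l_distr smult_r_distr smult_assoc1\<close>)
qed


subsection \<open>Index sets in the definition of \<open>\<sigma>[M]\<close>\<close>

lemma quotient_embedding_transfer:
  assumes N: "left_module R N" and D: "left_module R D" and D': "left_module R D'"
    and K: "submodule K R D" and h: "h \<in> lmod_hom R N (quotient_lmod D K)"
    and inj: "inj_on h (carrier N)"
    and \<theta>: "\<theta> \<in> lmod_hom R D' D"
    and ex: "\<And>n. n \<in> carrier N \<Longrightarrow> \<exists>d\<in>carrier D'. h n = K +>\<^bsub>D\<^esub> \<theta> d"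
  shows "\<exists>K' h'. submodule K' R D' \<and> h' \<in> lmod_hom R N (quotient_lmod D' K') \<and> inj_on h' (carrier N)"
proof -
  interpret N: left_module R N by fact
  interpret D: left_module R D by fact
  interpret D': left_module R D' by fact
  define K' where "K' = {d \<in> carrier D'. \<theta> d \<in> K}"
  have K': "submodule K' R D'" unfolding K'_def by (rule submodule_vimage[OF D' D \<theta> K])
  obtain c where c: "\<And>n. n \<in> carrier N \<Longrightarrow> c n \<in> carrier D'"
    and hc: "\<And>n. n \<in> carrier N \<Longrightarrow> h n = K +>\<^bsub>D\<^esub> \<theta> (c n)"
    using ex by metis
  note \<theta>D = lmod_homD[OF \<theta>]
  have eq: "K' +>\<^bsub>D'\<^esub> x = K' +>\<^bsub>D'\<^esub> y \<longleftrightarrow> K +>\<^bsub>D\<^esub> \<theta> x = K +>\<^bsub>D\<^esub> \<theta> y"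
    if xy: "x \<in> carrier D'" "y \<in> carrier D'" for x y
  proof -
    have "\<theta> (x \<oplus>\<^bsub>D'\<^esub> (\<ominus>\<^bsub>D'\<^esub> y)) = \<theta> x \<oplus>\<^bsub>D\<^esub> (\<ominus>\<^bsub>D\<^esub> \<theta> y)"
      using xy by (simp add: \<theta>D lmod_hom_minus[OF D' D \<theta>])
    then show ?thesis
      using xy by (simp add: D'.coset_eq_iff[OF K'] D.coset_eq_iff[OF K] \<theta>D(1)) (simp add: K'_def)
  qed
  define h' where "h' = (\<lambda>n. K' +>\<^bsub>D'\<^esub> c n)"
  have "h' \<in> lmod_hom R N (quotient_lmod D' K')"
  proof (rule lmod_homI)
    show "h' n \<in> carrier (quotient_lmod D' K')" if "n \<in> carrier N" for n
      using c[OF that] by (auto simp: D'.quotient_carrier h'_def)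
    show "h' (x \<oplus>\<^bsub>N\<^esub> y) = h' x \<oplus>\<^bsub>quotient_lmod D' K'\<^esub> h' y"
      if xy: "x \<in> carrier N" "y \<in> carrier N" for x y
    proof -
      have "K +>\<^bsub>D\<^esub> \<theta> (c (x \<oplus>\<^bsub>N\<^esub> y)) = K +>\<^bsub>D\<^esub> \<theta> (c x \<oplus>\<^bsub>D'\<^esub> c y)"
        using xy lmod_homD(2)[OF h xy] D.quotient_add[OF K \<theta>D(1)[OF c] \<theta>D(1)[OF c], OF xy]
          \<theta>D(2)[OF c c, OF xy] by (metis hc N.a_closed)
      then show ?thesis
        using xy by (simp add: h'_def D'.quotient_add[OF K'] c eq)
    qed
    show "h' (r \<odot>\<^bsub>N\<^esub> x) = r \<odot>\<^bsub>quotient_lmod D' K'\<^esub> h' x"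
      if rx: "r \<in> carrier R" "x \<in> carrier N" for r x
    proof -
      have "K +>\<^bsub>D\<^esub> \<theta> (c (r \<odot>\<^bsub>N\<^esub> x)) = K +>\<^bsub>D\<^esub> \<theta> (r \<odot>\<^bsub>D'\<^esub> c x)"
        using rx lmod_homD(3)[OF h rx] D.quotient_smult[OF K rx(1) \<theta>D(1)[OF c[OF rx(2)]]]
          \<theta>D(3)[OF rx(1) c[OF rx(2)]] by (metis hc N.smult_closed)
      then show ?thesis
        using rx by (simp add: h'_def D'.quotient_smult[OF K'] c eq)
    qed
  qed
  moreover have "inj_on h' (carrier N)"
  proof (rule inj_onI)
    fix x y assume xy: "x \<in> carrier N" "y \<in> carrier N" and "h' x = h' y"
    then have "h x = h y" by (simp add: h'_def eq c hc)
    then show "x = y" using inj xy by (auto dest: inj_onD)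
  qed
  ultimately show ?thesis using K' by blast
qed

lemma in_sigma_any_index:
  fixes R :: "'r ring" and M :: "('r, 'm) module" and N :: "('r, 'n) module"
  assumes M: "left_module R M" and sig: "in_sigma_idx TYPE('i) R M N"
  shows "in_sigma R M N"
proof -
  from sig have N: "left_module R N" by (simp add: in_sigma_idx_def)
  from sig obtain I :: "'i set" and K h where
    K: "submodule K R (direct_sum_copies I M)"
    and h: "h \<in> lmod_hom R N (quotient_lmod (direct_sum_copies I M) K)"
    and inj: "inj_on h (carrier N)" by (auto simp: in_sigma_idx_def)
  interpret M: left_module R M by fact
  let ?D = "direct_sum_copies I M"
  let ?supp = "\<lambda>x. {i. x i \<noteq> \<zero>\<^bsub>M\<^esub>}"
  have D: "left_module R ?D" by (rule direct_sum_left_module[OF M])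
  have "\<exists>x\<in>carrier ?D. h n = K +>\<^bsub>?D\<^esub> x" if "n \<in> carrier N" for n
    using lmod_homD(1)[OF h that] by (auto simp: left_module.quotient_carrier[OF D])
  then obtain c where c: "\<And>n. n \<in> carrier N \<Longrightarrow> c n \<in> carrier ?D"
    and hc: "\<And>n. n \<in> carrier N \<Longrightarrow> h n = K +>\<^bsub>?D\<^esub> c n" by metis
  have cD: "c n i \<in> carrier M" "?supp (c n) \<subseteq> I" "finite (?supp (c n))" if "n \<in> carrier N" for n i
    using c[OF that] by (auto simp: direct_sum_copies_def)
  define J where "J = (\<Union>n\<in>carrier N. ?supp (c n))"
  have JI: "J \<subseteq> I" using cD(2) by (auto simp: J_def)
  have "\<exists>n\<in>carrier N. j \<in> ?supp (c n)" if "j \<in> J" for j using that by (auto simp: J_def)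
  then obtain b where b: "\<And>j. j \<in> J \<Longrightarrow> b j \<in> carrier N \<and> j \<in> ?supp (c (b j))" by metis
  define e where "e = (\<lambda>j. (b j, to_nat_on (?supp (c (b j))) j))"
  have inj_e: "inj_on e J"
  proof (rule inj_onI)
    fix i j assume ij: "i \<in> J" "j \<in> J" "e i = e j"
    then have bb: "b i = b j" by (simp add: e_def)
    have "countable (?supp (c (b j)))" using b[OF ij(2)] cD(3) by (auto intro: countable_finite)
    then have "inj_on (to_nat_on (?supp (c (b j)))) (?supp (c (b j)))" by (rule inj_on_to_nat_on)
    then show "i = j" using ij b[OF ij(1)] b[OF ij(2)] bb by (auto simp: e_def dest: inj_onD)
  qed
  let ?D' = "direct_sum_copies (e ` J) M"
  have D': "left_module R ?D'" by (rule direct_sum_left_module[OF M])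
  define \<theta> where "\<theta> = (\<lambda>(x :: 'n \<times> nat \<Rightarrow> 'm) j. if j \<in> J then x (e j) else \<zero>\<^bsub>M\<^esub>)"
  have \<theta>: "\<theta> \<in> lmod_hom R ?D' ?D"
  proof (rule lmod_homI)
    show "\<theta> x \<in> carrier ?D" if x: "x \<in> carrier ?D'" for x
    proof -
      have "e ` ?supp (\<theta> x) \<subseteq> ?supp x" by (auto simp: \<theta>_def split: if_splits)
      moreover have "finite (?supp x)" using x by (simp add: direct_sum_copies_def)
      ultimately have "finite (e ` ?supp (\<theta> x))" by (rule finite_subset)
      moreover have sJ: "?supp (\<theta> x) \<subseteq> J" by (auto simp: \<theta>_def)
      ultimately have "finite (?supp (\<theta> x))"
        using finite_imageD inj_on_subset[OF inj_e] by blast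
      moreover have "\<theta> x j \<in> carrier M" for j
        using x by (simp add: direct_sum_copies_def \<theta>_def del: split_paired_All)
      ultimately show ?thesis using sJ JI by (auto simp: direct_sum_copies_def)
    qed
  qed (auto simp: direct_sum_copies_def \<theta>_def)
  have "\<exists>d\<in>carrier ?D'. h n = K +>\<^bsub>?D\<^esub> \<theta> d" if n: "n \<in> carrier N" for n
  proof -
    define d where "d = (\<lambda>k. if k \<in> e ` J then c n (inv_into J e k) else \<zero>\<^bsub>M\<^esub>)"
    have "\<theta> d j = c n j" for j
    proof (cases "j \<in> J")
      case True then show ?thesis by (simp add: \<theta>_def d_def inv_into_f_f[OF inj_e])
    next
      case False
      then have "c n j = \<zero>\<^bsub>M\<^esub>" using n by (auto simp: J_def)
      with False show ?thesis by (simp add: \<theta>_def)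
    qed
    then have eq: "\<theta> d = c n" by auto
    have "?supp d \<subseteq> e ` ?supp (c n)"
    proof
      fix k assume "k \<in> ?supp d"
      then obtain j where j: "j \<in> J" "k = e j" "d k \<noteq> \<zero>\<^bsub>M\<^esub>"
        by (auto simp: d_def split: if_splits)
      then have "c n j \<noteq> \<zero>\<^bsub>M\<^esub>" by (simp add: d_def inv_into_f_f[OF inj_e])
      with j show "k \<in> e ` ?supp (c n)" by auto
    qed
    moreover have "?supp d \<subseteq> e ` J" by (auto simp: d_def)
    moreover have "finite (?supp d)"
      using finite_subset[OF calculation(1)] cD(3)[OF n] by simp
    moreover have "d k \<in> carrier M" for k using cD(1)[OF n] by (simp add: d_def)
    ultimately have "d \<in> carrier ?D'" by (simp add: direct_sum_copies_def)
    then show ?thesis using eq hc[OF n] by (intro bexI[of _ d]) simp_all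
  qed
  from quotient_embedding_transfer[OF N D D' K h inj \<theta> this]
  show ?thesis using N unfolding in_sigma_def in_sigma_idx_def by blast
qed

lemma in_sigma_mono:
  fixes R :: "'r ring" and M :: "('r, 'm) module"
    and N :: "('r, 'n) module" and N' :: "('r, 'k) module"
  assumes M: "left_module R M" and sig: "in_sigma R M N"
    and N': "left_module R N'" and k: "k \<in> lmod_hom R N' N" and inj: "inj_on k (carrier N')"
  shows "in_sigma R M N'"
proof -
  from sig obtain I :: "('n \<times> nat) set" and K h where
    K: "submodule K R (direct_sum_copies I M)"
    and h: "h \<in> lmod_hom R N (quotient_lmod (direct_sum_copies I M) K)"
    and injh: "inj_on h (carrier N)" by (auto simp: in_sigma_def in_sigma_idx_def)
  have "inj_on (\<lambda>x. h (k x)) (carrier N')"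
    using inj injh lmod_homD(1)[OF k] by (auto simp: inj_on_def)
  with K lmod_hom_comp[OF k h] N' have "in_sigma_idx TYPE('n \<times> nat) R M N'"
    by (auto simp: in_sigma_idx_def)
  then show ?thesis by (rule in_sigma_any_index[OF M])
qed


subsection \<open>Test modules in the definition of projectivity\<close>

definition transport_lmod :: "('a \<Rightarrow> 'u) \<Rightarrow> ('r, 'a) module \<Rightarrow> ('r, 'u) module" where
  "transport_lmod j A = (let k = inv_into (carrier A) j in
    \<lparr>carrier = j ` carrier A, mult = (\<lambda>x y. j (k x \<otimes>\<^bsub>A\<^esub> k y)), one = j \<one>\<^bsub>A\<^esub>, zero = j \<zero>\<^bsub>A\<^esub>,
     add = (\<lambda>x y. j (k x \<oplus>\<^bsub>A\<^esub> k y)), smult = (\<lambda>r x. j (r \<odot>\<^bsub>A\<^esub> k x))\<rparr>)"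

lemma transport_lmod:
  assumes A: "left_module R A" and inj: "inj_on j (carrier A)"
  shows "left_module R (transport_lmod j A)"
    and "j \<in> lmod_hom R A (transport_lmod j A)"
    and "inv_into (carrier A) j \<in> lmod_hom R (transport_lmod j A) A"
    and "carrier (transport_lmod j A) = j ` carrier A"
proof -
  interpret A: left_module R A by fact
  have [simp]: "inv_into (carrier A) j (j x) = x" if "x \<in> carrier A" for x
    using that inj by simp
  show "j \<in> lmod_hom R A (transport_lmod j A)"
    by (rule lmod_homI) (auto simp: transport_lmod_def Let_def)
  show "inv_into (carrier A) j \<in> lmod_hom R (transport_lmod j A) A"
    by (rule lmod_homI) (auto simp: transport_lmod_def Let_def)
  show "carrier (transport_lmod j A) = j ` carrier A" by (simp add: transport_lmod_def Let_def)
  show "left_module R (transport_lmod j A)"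
  proof (intro left_module.intro left_module_axioms.intro)
    show "ring R" by (rule A.R.ring_axioms)
    show "abelian_group (transport_lmod j A)"
    proof (rule abelian_groupI)
      fix x assume "x \<in> carrier (transport_lmod j A)"
      then obtain a where a: "a \<in> carrier A" "x = j a" by (auto simp: transport_lmod_def Let_def)
      then show "\<exists>y\<in>carrier (transport_lmod j A).
          y \<oplus>\<^bsub>transport_lmod j A\<^esub> x = \<zero>\<^bsub>transport_lmod j A\<^esub>"
        by (intro bexI[of _ "j (\<ominus>\<^bsub>A\<^esub> a)"]) (auto simp: transport_lmod_def Let_def A.l_neg)
    qed (auto simp: transport_lmod_def Let_def A.a_ac)
  qed (auto simp: transport_lmod_def Let_def A.smult_l_distr A.smult_r_distr A.smult_assoc1)
qed

lemma projective_in_sigma_any_type: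
  fixes R :: "'r ring" and M :: "('r, 'm) module" and P :: "('r, 'p) module"
  assumes M: "left_module R M" and proj: "projective_in_sigma R M P"
  shows "projective_in_sigma_wrt TYPE('a) TYPE('b) R M P"
proof -
  have P: "in_sigma R M P"
    using proj by (simp add: projective_in_sigma_def projective_in_sigma_wrt_def)
  then have lP: "left_module R P" by (simp add: in_sigma_def in_sigma_idx_def)
  interpret P: left_module R P by fact
  have "\<exists>h\<in>lmod_hom R P A. \<forall>x\<in>carrier P. g (h x) = f x"
    if A: "in_sigma R M A" and B: "in_sigma R M B"
      and g: "g \<in> lmod_epi R A B" and f: "f \<in> lmod_hom R P B"
    for A :: "('r, 'a) module" and B :: "('r, 'b) module" and g f
  proof -
    have lA: "left_module R A" and lB: "left_module R B"
      using A B by (simp_all add: in_sigma_def in_sigma_idx_def)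
    interpret A: left_module R A by fact
    interpret B: left_module R B by fact
    have gh: "g \<in> lmod_hom R A B" and gs: "g ` carrier A = carrier B"
      using g by (auto simp: lmod_epi_def)
    have "\<exists>a\<in>carrier A. g a = f p" if "p \<in> carrier P" for p
      using lmod_homD(1)[OF f that] gs by (metis image_iff)
    then obtain a where a: "\<And>p. p \<in> carrier P \<Longrightarrow> a p \<in> carrier A"
      and ga: "\<And>p. p \<in> carrier P \<Longrightarrow> g (a p) = f p" by metis
    define ev where "ev = (\<lambda>l :: ('r \<times> 'p) list. foldr (\<lambda>(r, p) s. r \<odot>\<^bsub>A\<^esub> a p \<oplus>\<^bsub>A\<^esub> s) l \<zero>\<^bsub>A\<^esub>)"
    have ev_simps: "ev [] = \<zero>\<^bsub>A\<^esub>" "ev ((r, p) # l) = r \<odot>\<^bsub>A\<^esub> a p \<oplus>\<^bsub>A\<^esub> ev l" for r p l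
      by (simp_all add: ev_def)
    define W where "W = lists (carrier R \<times> carrier P)"
    have evA: "ev l \<in> carrier A" if "l \<in> W" for l
      using that unfolding W_def by (induction l rule: lists.induct) (auto simp: ev_simps a)
    have ev_app: "ev (l @ l') = ev l \<oplus>\<^bsub>A\<^esub> ev l'" if "l \<in> W" "l' \<in> W" for l l'
      using that(1) unfolding W_def
    proof (induction l rule: lists.induct)
      case Nil then show ?case using evA[OF that(2)] by (simp add: ev_simps)
    next
      case (Cons x xs)
      moreover obtain r p where "x = (r, p)" by force
      ultimately show ?case
        using evA[OF that(2)] evA[of xs] by (auto simp: ev_simps a A.a_assoc W_def)
    qed
    have ev_smult: "\<exists>l'\<in>W. ev l' = s \<odot>\<^bsub>A\<^esub> ev l" if s: "s \<in> carrier R" and "l \<in> W" for s l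
      using that(2) unfolding W_def
    proof (induction l rule: lists.induct)
      case Nil then show ?case using s by (intro bexI[of _ "[]"]) (auto simp: ev_simps)
    next
      case (Cons x xs)
      then obtain l' where l': "l' \<in> W" "ev l' = s \<odot>\<^bsub>A\<^esub> ev xs" by (auto simp: W_def)
      obtain r p where x: "x = (r, p)" by force
      then have rp: "r \<in> carrier R" "p \<in> carrier P" using Cons by auto
      have "ev xs \<in> carrier A" using Cons evA by (simp add: W_def)
      then have "ev ((s \<otimes>\<^bsub>R\<^esub> r, p) # l') = s \<odot>\<^bsub>A\<^esub> ev (x # xs)"
        using rp s l' by (simp add: x ev_simps a A.smult_r_distr A.smult_assoc1)
      moreover have "(s \<otimes>\<^bsub>R\<^esub> r, p) # l' \<in> lists (carrier R \<times> carrier P)"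
        using rp s l' by (auto simp: W_def)
      ultimately show ?case by blast
    qed
    define S where "S = ev ` W"
    have S: "submodule S R A"
    proof (rule A.submodule_smultI)
      show "S \<subseteq> carrier A" using evA by (auto simp: S_def)
      show "\<zero>\<^bsub>A\<^esub> \<in> S" using ev_simps(1) by (auto simp: S_def W_def intro!: image_eqI[of _ _ "[]"])
      show "x \<oplus>\<^bsub>A\<^esub> y \<in> S" if xy: "x \<in> S" "y \<in> S" for x y
      proof -
        obtain l l' where l: "l \<in> W" "x = ev l" "l' \<in> W" "y = ev l'" using xy by (auto simp: S_def)
        moreover have "l @ l' \<in> W" using l by (auto simp: W_def)
        ultimately show ?thesis using ev_app[of l l'] by (auto simp: S_def intro!: image_eqI[of _ _ "l @ l'"])
      qed
      show "s \<odot>\<^bsub>A\<^esub> x \<in> S" if sx: "s \<in> carrier R" "x \<in> S" for s x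
      proof -
        obtain l where l: "l \<in> W" "x = ev l" using sx(2) by (auto simp: S_def)
        obtain l' where "l' \<in> W" "ev l' = s \<odot>\<^bsub>A\<^esub> ev l" using ev_smult[OF sx(1) l(1)] by blast
        then show ?thesis unfolding S_def l(2) by (metis imageI)
      qed
    qed
    define F where "F = f ` carrier P"
    have F: "submodule F R B" unfolding F_def by (rule submodule_image[OF lP lB f])
    note FD = B.submoduleD[OF F]
    have gev: "g (ev l) \<in> F" if "l \<in> W" for l
      using that unfolding W_def
    proof (induction l rule: lists.induct)
      case Nil then show ?case using lmod_hom_zero[OF lA lB gh] FD(2) by (simp add: ev_simps)
    next
      case (Cons x xs)
      obtain r p where x: "x = (r, p)" by force
      then have rp: "r \<in> carrier R" "p \<in> carrier P" using Cons by auto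
      have "ev xs \<in> carrier A" using Cons evA by (simp add: W_def)
      then have "g (ev (x # xs)) = r \<odot>\<^bsub>B\<^esub> f p \<oplus>\<^bsub>B\<^esub> g (ev xs)"
        using rp by (simp add: x ev_simps a lmod_homD[OF gh] ga)
      moreover have "f p \<in> F" using rp by (simp add: F_def)
      ultimately show ?case using Cons FD rp by simp
    qed
    have aS: "a p \<in> S" if "p \<in> carrier P" for p
    proof -
      have "ev [(\<one>\<^bsub>R\<^esub>, p)] = a p" using that by (simp add: ev_simps a)
      moreover have "[(\<one>\<^bsub>R\<^esub>, p)] \<in> W" using that by (simp add: W_def)
      ultimately show ?thesis unfolding S_def by (metis imageI)
    qed
    let ?A0 = "A\<lparr>carrier := S\<rparr>" and ?B0 = "B\<lparr>carrier := F\<rparr>"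
    have lA0: "left_module R ?A0" by (rule A.submodule_left_module[OF S])
    have lB0: "left_module R ?B0" by (rule B.submodule_left_module[OF F])
    define jA where "jA = inv_into W ev"
    define jB where "jB = inv_into (carrier P) f"
    have injA: "inj_on jA (carrier ?A0)" by (simp add: jA_def S_def inj_on_inv_into)
    have injB: "inj_on jB (carrier ?B0)" by (simp add: jB_def F_def inj_on_inv_into)
    define A1 where "A1 = transport_lmod jA ?A0"
    define B1 where "B1 = transport_lmod jB ?B0"
    note tA = transport_lmod[OF lA0 injA, folded A1_def]
    note tB = transport_lmod[OF lB0 injB, folded B1_def]
    define kA where "kA = inv_into (carrier ?A0) jA"
    define kB where "kB = inv_into (carrier ?B0) jB"
    have incA: "(\<lambda>x. x) \<in> lmod_hom R ?A0 A" using A.submoduleD(1)[OF S] by (intro lmod_homI) auto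
    have incB: "(\<lambda>x. x) \<in> lmod_hom R ?B0 B" using FD(1) by (intro lmod_homI) auto
    have kA: "kA \<in> lmod_hom R A1 A" unfolding kA_def using lmod_hom_comp[OF tA(3) incA] by simp
    have kB: "kB \<in> lmod_hom R B1 B" unfolding kB_def using lmod_hom_comp[OF tB(3) incB] by simp
    have kjA: "kA (jA x) = x" if "x \<in> S" for x using that injA by (simp add: kA_def)
    have kjB: "kB (jB x) = x" if "x \<in> F" for x using that injB by (simp add: kB_def)
    have A1: "in_sigma R M A1"
      by (rule in_sigma_mono[OF M A tA(1) kA]) (simp add: kA_def tA(4) inj_on_inv_into)
    have B1: "in_sigma R M B1"
      by (rule in_sigma_mono[OF M B tB(1) kB]) (simp add: kB_def tB(4) inj_on_inv_into)
    have SA: "x \<in> carrier A" if "x \<in> S" for x using that A.submoduleD(1)[OF S] by blast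
    have gS: "g x \<in> F" if "x \<in> S" for x using that gev unfolding S_def by blast
    have g0: "g \<in> lmod_hom R ?A0 ?B0"
      by (intro lmod_homI) (simp_all add: SA gS lmod_homD(2,3)[OF gh])
    define g1 where "g1 = (\<lambda>x. jB (g (kA x)))"
    have g1h: "g1 \<in> lmod_hom R A1 B1"
      unfolding g1_def kA_def by (rule lmod_hom_comp[OF lmod_hom_comp[OF tA(3) g0] tB(2)])
    have "g1 ` carrier A1 = carrier B1"
    proof
      show "g1 ` carrier A1 \<subseteq> carrier B1" using lmod_homD(1)[OF g1h] by auto
      show "carrier B1 \<subseteq> g1 ` carrier A1"
      proof
        fix y assume "y \<in> carrier B1"
        then obtain p where p: "p \<in> carrier P" "y = jB (f p)" by (auto simp: tB(4) F_def)
        then have "g1 (jA (a p)) = y" by (simp add: g1_def kjA aS ga)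
        moreover have "jA (a p) \<in> carrier A1" using aS[OF p(1)] by (simp add: tA(4))
        ultimately show "y \<in> g1 ` carrier A1" by blast
      qed
    qed
    with g1h have g1: "g1 \<in> lmod_epi R A1 B1" by (simp add: lmod_epi_def)
    have f0: "f \<in> lmod_hom R P ?B0"
      using lmod_homD(2,3)[OF f] by (intro lmod_homI) (auto simp: F_def)
    have f1: "(\<lambda>p. jB (f p)) \<in> lmod_hom R P B1" by (rule lmod_hom_comp[OF f0 tB(2)])
    from proj A1 B1 g1 f1 obtain h where h: "h \<in> lmod_hom R P A1"
      and gh1: "\<forall>p\<in>carrier P. g1 (h p) = jB (f p)"
      unfolding projective_in_sigma_def projective_in_sigma_wrt_def by blast
    have "g (kA (h p)) = f p" if p: "p \<in> carrier P" for p
    proof -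
      have "kA (h p) \<in> S"
        using lmod_homD(1)[OF h p] lmod_homD(1)[OF tA(3)] by (simp add: kA_def)
      then have "g (kA (h p)) \<in> F" using gev by (auto simp: S_def)
      moreover have "f p \<in> F" using p by (simp add: F_def)
      moreover have "jB (g (kA (h p))) = jB (f p)" using gh1 p by (simp add: g1_def)
      ultimately show ?thesis using kjB by metis
    qed
    then show ?thesis by (intro bexI[OF _ lmod_hom_comp[OF h kA]] ballI)
  qed
  then show ?thesis unfolding projective_in_sigma_wrt_def by (intro conjI P allI impI) (elim conjE)
qed

end

theory Submission
  imports Defs
begin

text \<open>
  The projective cover \<open>P\<close> maps onto every codense cover \<open>q : Z \<rightarrow> X\<close>: the cokernel of a lifting
  \<open>h : P \<rightarrow> Z\<close> of \<open>\<pi>\<close> is a factor of \<open>Ker q\<close>, hence zero. The central point is that then every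
  \<open>d : P \<rightarrow> Ker q\<close> vanishes: modulo \<open>L = d (Ker h)\<close> it factors through \<open>h\<close>, so that \<open>d\<close> has image
  \<open>L\<close> by codensity; thus \<open>P = Ker h + Ker d\<close>, and \<open>Ker h \<subseteq> Ker \<pi>\<close> is small. Applied to \<open>h \<circ> g\<close> with
  \<open>g : P \<rightarrow> Ker \<pi>\<close> this shows that \<open>h\<close> kills \<open>T\<close>; applied to the difference of two liftings
  it gives uniqueness. Codensity of \<open>P/T\<close> holds because a map from \<open>P\<close> to a factor module of
  \<open>Ker \<pi> / T\<close> lifts to \<open>Ker \<pi>\<close>, and the lifting has image in \<open>T\<close>.
\<close>

section \<open>Images, kernels, factor modules and factorization of homomorphisms\<close>

text \<open>Every module axiom is an equation or a closure condition that a surjection compatible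
  with the operations carries over from \<open>U\<close>. The zero is a separate premise because
  \<open>lmod_hom\<close> says nothing about the \<open>zero\<close> field of \<open>V\<close>,
  which is not yet known to be a module. This is how factor modules are shown to be modules.\<close>

lemma left_module_surj_image:
  assumes U: "left_module R U" and f: "f \<in> lmod_hom R U V"
    and surj: "f ` carrier U = carrier V" and zero: "f \<zero>\<^bsub>U\<^esub> = \<zero>\<^bsub>V\<^esub>"
  shows "left_module R V"
proof -
  interpret U: left_module R U by fact
  note fD = lmod_homD(2,3)[OF f, symmetric]
  have im: "\<exists>a\<in>carrier U. x = f a" if "x \<in> carrier V" for x using that surj by blast
  have mem: "f a \<in> carrier V" if "a \<in> carrier U" for a by (rule lmod_homD(1)[OF f that])
  show ?thesis
  proof (intro left_module.intro left_module_axioms.intro)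
    show "ring R" by (rule U.R.ring_axioms)
    show "abelian_group V"
    proof (rule abelian_groupI)
      show "\<zero>\<^bsub>V\<^esub> \<in> carrier V" using mem[of "\<zero>\<^bsub>U\<^esub>"] zero by simp
      show "\<zero>\<^bsub>V\<^esub> \<oplus>\<^bsub>V\<^esub> x = x" if "x \<in> carrier V" for x
        using im[OF that] by (auto simp: fD zero[symmetric])
      show "\<exists>y\<in>carrier V. y \<oplus>\<^bsub>V\<^esub> x = \<zero>\<^bsub>V\<^esub>" if x: "x \<in> carrier V" for x
      proof -
        obtain a where a: "a \<in> carrier U" "x = f a" using im[OF x] by blast
        then show ?thesis
          using mem by (intro bexI[of _ "f (\<ominus>\<^bsub>U\<^esub> a)"]) (auto simp: fD U.l_neg zero)
      qed
      show "x \<oplus>\<^bsub>V\<^esub> y \<oplus>\<^bsub>V\<^esub> z = x \<oplus>\<^bsub>V\<^esub> (y \<oplus>\<^bsub>V\<^esub> z)"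
        if "x \<in> carrier V" "y \<in> carrier V" "z \<in> carrier V" for x y z
        using that[THEN im] by (auto simp: fD U.a_assoc)
      show "x \<oplus>\<^bsub>V\<^esub> y = y \<oplus>\<^bsub>V\<^esub> x" if "x \<in> carrier V" "y \<in> carrier V" for x y
        using that[THEN im] by (auto simp: fD U.a_comm)
      show "x \<oplus>\<^bsub>V\<^esub> y \<in> carrier V" if "x \<in> carrier V" "y \<in> carrier V" for x y
        using that[THEN im] by (auto simp: fD mem)
    qed
    show "a \<odot>\<^bsub>V\<^esub> x \<in> carrier V" if "a \<in> carrier R" "x \<in> carrier V" for a x
      using im[OF that(2)] that(1) by (auto simp: fD mem)
    show "(a \<oplus>\<^bsub>R\<^esub> b) \<odot>\<^bsub>V\<^esub> x = a \<odot>\<^bsub>V\<^esub> x \<oplus>\<^bsub>V\<^esub> b \<odot>\<^bsub>V\<^esub> x"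
      if "a \<in> carrier R" "b \<in> carrier R" "x \<in> carrier V" for a b x
      using im[OF that(3)] that(1,2) by (auto simp: fD U.smult_l_distr)
    show "a \<odot>\<^bsub>V\<^esub> (x \<oplus>\<^bsub>V\<^esub> y) = a \<odot>\<^bsub>V\<^esub> x \<oplus>\<^bsub>V\<^esub> a \<odot>\<^bsub>V\<^esub> y"
      if "a \<in> carrier R" "x \<in> carrier V" "y \<in> carrier V" for a x y
      using im[OF that(2)] im[OF that(3)] that(1) by (auto simp: fD U.smult_r_distr)
    show "(a \<otimes>\<^bsub>R\<^esub> b) \<odot>\<^bsub>V\<^esub> x = a \<odot>\<^bsub>V\<^esub> (b \<odot>\<^bsub>V\<^esub> x)"
      if "a \<in> carrier R" "b \<in> carrier R" "x \<in> carrier V" for a b x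
      using im[OF that(3)] that(1,2) by (auto simp: fD U.smult_assoc1)
    show "\<one>\<^bsub>R\<^esub> \<odot>\<^bsub>V\<^esub> x = x" if "x \<in> carrier V" for x
      using im[OF that] by (auto simp: fD)
  qed
qed

lemma lmod_epiD:
  assumes "f \<in> lmod_epi R U V"
  shows "f \<in> lmod_hom R U V" and "f ` carrier U = carrier V"
  using assms by (auto simp: lmod_epi_def)

lemma lmod_epi_comp:
  assumes "f \<in> lmod_epi R U V" "g \<in> lmod_epi R V W"
  shows "(\<lambda>x. g (f x)) \<in> lmod_epi R U W"
  using lmod_hom_comp[OF assms[THEN lmod_epiD(1)]] assms[THEN lmod_epiD(2)]
  by (auto simp: lmod_epi_def image_image[symmetric])

lemma in_a_kernel_iff: "x \<in> a_kernel U V f \<longleftrightarrow> x \<in> carrier U \<and> f x = \<zero>\<^bsub>V\<^esub>"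
  by (auto simp: a_kernel_def')

lemma submodule_a_kernel:
  assumes "left_module R U" "left_module R V" "f \<in> lmod_hom R U V"
  shows "submodule (a_kernel U V f) R U"
proof -
  interpret U: left_module R U by fact
  interpret V: left_module R V by fact
  show ?thesis
    using lmod_homD[OF assms(3)] lmod_hom_zero[OF assms]
    by (intro U.submodule_smultI) (auto simp: in_a_kernel_iff)
qed

lemma quotient_zero: "\<zero>\<^bsub>quotient_lmod M H\<^esub> = H"
  by (simp add: quotient_lmod_def)

context left_module
begin

lemma submodule_restrict_iff:
  assumes "submodule K R M"
  shows "submodule L R (M\<lparr>carrier := K\<rparr>) \<longleftrightarrow> submodule L R M \<and> L \<subseteq> K"
proof
  interpret K: left_module R "M\<lparr>carrier := K\<rparr>" by (rule submodule_left_module) fact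
  note KD = submoduleD[OF assms]
  show "submodule L R M \<and> L \<subseteq> K" if "submodule L R (M\<lparr>carrier := K\<rparr>)"
    using K.submoduleD[OF that] KD(1) by (auto intro!: submodule_smultI)
  show "submodule L R (M\<lparr>carrier := K\<rparr>)" if "submodule L R M \<and> L \<subseteq> K"
    using submoduleD[of L] that by (auto intro!: K.submodule_smultI)
qed

lemma smult_r_minus:
  assumes "a \<in> carrier R" "x \<in> carrier M"
  shows "a \<odot>\<^bsub>M\<^esub> (\<ominus>\<^bsub>M\<^esub> x) = \<ominus>\<^bsub>M\<^esub> (a \<odot>\<^bsub>M\<^esub> x)"
proof -
  have "a \<odot>\<^bsub>M\<^esub> (\<ominus>\<^bsub>M\<^esub> x) \<oplus>\<^bsub>M\<^esub> a \<odot>\<^bsub>M\<^esub> x = \<zero>\<^bsub>M\<^esub>"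
    using assms by (simp add: smult_r_distr[symmetric] M.l_neg)
  then show ?thesis using assms by (simp add: M.minus_equality)
qed

lemma add_minus_eq_zero_iff:
  assumes "x \<in> carrier M" "y \<in> carrier M"
  shows "x \<oplus>\<^bsub>M\<^esub> (\<ominus>\<^bsub>M\<^esub> y) = \<zero>\<^bsub>M\<^esub> \<longleftrightarrow> x = y"
proof
  assume "x \<oplus>\<^bsub>M\<^esub> (\<ominus>\<^bsub>M\<^esub> y) = \<zero>\<^bsub>M\<^esub>"
  moreover have "x \<oplus>\<^bsub>M\<^esub> (\<ominus>\<^bsub>M\<^esub> y) \<oplus>\<^bsub>M\<^esub> y = x" using assms by (simp add: M.a_assoc M.l_neg)
  ultimately show "x = y" using assms by simp
qed (use assms in \<open>simp add: M.r_neg\<close>)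

lemma coset_eq_self_iff:
  assumes "submodule H R M" "x \<in> carrier M"
  shows "H +>\<^bsub>M\<^esub> x = H \<longleftrightarrow> x \<in> H"
proof -
  interpret H: abelian_subgroup H M by (rule submodule_abelian_subgroup) fact
  have "H +>\<^bsub>M\<^esub> \<zero>\<^bsub>M\<^esub> = H" using submoduleD(1)[OF assms(1)] by (rule M.a_coset_add_zero)
  then show ?thesis
    using coset_eq_iff[OF assms, of "\<zero>\<^bsub>M\<^esub>"] M.minus_equality[of "\<zero>\<^bsub>M\<^esub>" "\<zero>\<^bsub>M\<^esub>"] assms(2) by simp
qed

end

lemma coset_map_epi:
  fixes R :: "'r ring" and M :: "('r, 'm) module"
  assumes "left_module R M" "submodule H R M"
  shows "(\<lambda>x. H +>\<^bsub>M\<^esub> x) \<in> lmod_epi R M (quotient_lmod M H)"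
proof -
  interpret left_module R M by fact
  show ?thesis unfolding lmod_epi_def
    by (auto intro!: lmod_homI
        simp: quotient_carrier quotient_add[OF assms(2)] quotient_smult[OF assms(2)])
qed

lemma quotient_left_module:
  fixes R :: "'r ring" and M :: "('r, 'm) module"
  assumes "left_module R M" "submodule H R M"
  shows "left_module R (quotient_lmod M H)"
proof -
  interpret left_module R M by fact
  show ?thesis
    using coset_eq_self_iff[OF assms(2)] submoduleD(2)[OF assms(2)]
    by (intro left_module_surj_image[OF assms(1) coset_map_epi[OF assms, THEN lmod_epiD(1)]
        coset_map_epi[OF assms, THEN lmod_epiD(2)]]) (simp add: quotient_zero)
qed

text \<open>The map \<open>k\<close> applies \<open>g\<close> to a chosen preimage under
  \<open>f\<close>. Two preimages differ by an element of the kernel of \<open>f\<close>, which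
  \<open>g\<close> kills, so the choice does not matter. All induced homomorphisms below come from
  here.\<close>

lemma lmod_hom_factor:
  assumes U: "left_module R U" and V: "left_module R V" and W: "left_module R W"
    and f: "f \<in> lmod_epi R U V" and g: "g \<in> lmod_hom R U W"
    and ker: "\<And>x. \<lbrakk>x \<in> carrier U; f x = \<zero>\<^bsub>V\<^esub>\<rbrakk> \<Longrightarrow> g x = \<zero>\<^bsub>W\<^esub>"
  obtains k where "k \<in> lmod_hom R V W" and "\<And>x. x \<in> carrier U \<Longrightarrow> k (f x) = g x"
proof -
  interpret U: left_module R U by fact
  interpret V: left_module R V by fact
  interpret W: left_module R W by fact
  note fh = lmod_epiD(1)[OF f] and fs = lmod_epiD(2)[OF f]
  note fD = lmod_homD[OF fh] and gD = lmod_homD[OF g]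
  have eq: "g x = g y" if "x \<in> carrier U" "y \<in> carrier U" "f x = f y" for x y
  proof -
    have "f (x \<oplus>\<^bsub>U\<^esub> (\<ominus>\<^bsub>U\<^esub> y)) = \<zero>\<^bsub>V\<^esub>"
      using that by (simp add: fD lmod_hom_minus[OF U V fh] V.r_neg)
    then have "g (x \<oplus>\<^bsub>U\<^esub> (\<ominus>\<^bsub>U\<^esub> y)) = \<zero>\<^bsub>W\<^esub>" using that by (intro ker) auto
    then have "g x \<oplus>\<^bsub>W\<^esub> (\<ominus>\<^bsub>W\<^esub> g y) = \<zero>\<^bsub>W\<^esub>"
      using that by (simp add: gD lmod_hom_minus[OF U W g])
    then show ?thesis using that gD(1) by (simp add: W.add_minus_eq_zero_iff)
  qed
  define k where "k = (\<lambda>v. g (inv_into (carrier U) f v))"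
  have kf: "k (f x) = g x" if "x \<in> carrier U" for x
    unfolding k_def using that by (intro eq) (auto intro: inv_into_into f_inv_into_f)
  have im: "\<exists>u\<in>carrier U. v = f u" if "v \<in> carrier V" for v using that fs by blast
  have "k \<in> lmod_hom R V W"
  proof (rule lmod_homI)
    show "k x \<in> carrier W" if "x \<in> carrier V" for x using im[OF that] by (auto simp: kf gD)
    show "k (x \<oplus>\<^bsub>V\<^esub> y) = k x \<oplus>\<^bsub>W\<^esub> k y" if "x \<in> carrier V" "y \<in> carrier V" for x y
      using that[THEN im] by (auto simp: kf gD fD(2)[symmetric])
    show "k (r \<odot>\<^bsub>V\<^esub> x) = r \<odot>\<^bsub>W\<^esub> k x" if "r \<in> carrier R" "x \<in> carrier V" for r x
      using that(1) im[OF that(2)] by (auto simp: kf gD fD(3)[symmetric])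
  qed
  with kf that show thesis by blast
qed

lemma lmod_hom_restrict_codomain:
  assumes "f \<in> lmod_hom R U V" "f ` carrier U \<subseteq> K"
  shows "f \<in> lmod_hom R U (V\<lparr>carrier := K\<rparr>)"
  using assms lmod_homD[OF assms(1)] by (auto intro!: lmod_homI)

lemma lmod_hom_inclusion:
  "K \<subseteq> carrier V \<Longrightarrow> (\<lambda>x. x) \<in> lmod_hom R (V\<lparr>carrier := K\<rparr>) V"
  by (auto intro!: lmod_homI)

section \<open>Closure of \<sigma>[M] under submodules and epimorphic images\<close>

lemma in_sigma_left_module: "in_sigma R M N \<Longrightarrow> left_module R N"
  by (simp add: in_sigma_def in_sigma_idx_def)

lemma in_sigma_submodule:
  assumes M: "left_module R M" and N: "in_sigma R M N" and K: "submodule K R N"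
  shows "in_sigma R M (N\<lparr>carrier := K\<rparr>)"
proof -
  interpret N: left_module R N by (rule in_sigma_left_module[OF N])
  show ?thesis
    by (rule in_sigma_mono[OF M N N.submodule_left_module[OF K]
          lmod_hom_inclusion[OF N.submoduleD(1)[OF K]]]) simp
qed

text \<open>
  If \<open>N\<close> embeds in \<open>D/K\<close>, then the preimage \<open>D0\<close> of \<open>N\<close> in \<open>D\<close> maps onto \<open>N'\<close>,
  and \<open>N'\<close> embeds in \<open>D/K'\<close>, where \<open>K'\<close> is the kernel of this map.
\<close>

lemma in_sigma_epi_image:
  fixes R :: "'r ring" and M :: "('r, 'm) module"
    and N :: "('r, 'n) module" and N' :: "('r, 'k) module"
  assumes M: "left_module R M" and sig: "in_sigma R M N"
    and N': "left_module R N'" and g: "g \<in> lmod_epi R N N'"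
  shows "in_sigma R M N'"
proof -
  from sig obtain I :: "('n \<times> nat) set" and K h where
    K: "submodule K R (direct_sum_copies I M)"
    and h: "h \<in> lmod_hom R N (quotient_lmod (direct_sum_copies I M) K)"
    and inj: "inj_on h (carrier N)" by (auto simp: in_sigma_def in_sigma_idx_def)
  define D where "D = direct_sum_copies I M"
  note K = K[folded D_def] and h = h[folded D_def]
  have N: "left_module R N" by (rule in_sigma_left_module[OF sig])
  have D: "left_module R D" unfolding D_def by (rule direct_sum_left_module[OF M])
  let ?Q = "quotient_lmod D K"
  have Q: "left_module R ?Q" by (rule quotient_left_module[OF D K])
  interpret N: left_module R N by fact
  interpret N': left_module R N' by fact
  interpret D: left_module R D by fact
  interpret Q: left_module R ?Q by fact
  have S: "submodule (h ` carrier N) R ?Q" by (rule submodule_image[OF N Q h])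
  let ?S = "?Q\<lparr>carrier := h ` carrier N\<rparr>"
  have lS: "left_module R ?S" by (rule Q.submodule_left_module[OF S])
  have hS: "h \<in> lmod_epi R N ?S"
    using lmod_hom_restrict_codomain[OF h subset_refl] by (simp add: lmod_epi_def)
  have id: "(\<lambda>x. x) \<in> lmod_hom R N N" by (rule lmod_homI) auto
  have inj0: "x = \<zero>\<^bsub>N\<^esub>" if "x \<in> carrier N" "h x = \<zero>\<^bsub>?S\<^esub>" for x
    using that lmod_hom_zero[OF N Q h] inj_onD[OF inj, of x "\<zero>\<^bsub>N\<^esub>"] by simp
  \<comment> \<open>Factoring the identity of \<open>N\<close> through \<open>h\<close> yields the
    inverse of \<open>h\<close> on its image; injectivity of \<open>h\<close> is the kernel
    condition.\<close>
  obtain k where k: "k \<in> lmod_hom R ?S N" and kh: "\<And>x. x \<in> carrier N \<Longrightarrow> k (h x) = x"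
    using lmod_hom_factor[OF N lS N hS id inj0] by blast
  let ?pr = "\<lambda>d. K +>\<^bsub>D\<^esub> d"
  note pr = coset_map_epi[OF D K]
  define C where "C = {d \<in> carrier D. ?pr d \<in> h ` carrier N}"
  have C: "submodule C R D"
    unfolding C_def by (rule submodule_vimage[OF D Q lmod_epiD(1)[OF pr] S])
  let ?D0 = "D\<lparr>carrier := C\<rparr>"
  have D0: "left_module R ?D0" by (rule D.submodule_left_module[OF C])
  interpret D0: left_module R ?D0 by fact
  have inc: "(\<lambda>x. x) \<in> lmod_hom R ?D0 D"
    by (rule lmod_hom_inclusion[OF D.submoduleD(1)[OF C]])
  have pr0: "?pr \<in> lmod_hom R ?D0 ?S"
    by (rule lmod_hom_restrict_codomain[OF lmod_hom_comp[OF inc lmod_epiD(1)[OF pr]]])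
      (auto simp: C_def)
  define \<phi> where "\<phi> = (\<lambda>d. g (k (?pr d)))"
  have \<phi>h: "\<phi> \<in> lmod_hom R ?D0 N'"
    unfolding \<phi>_def by (rule lmod_hom_comp[OF lmod_hom_comp[OF pr0 k] lmod_epiD(1)[OF g]])
  have "carrier N' \<subseteq> \<phi> ` C"
  proof
    fix y assume "y \<in> carrier N'"
    then obtain n where n: "n \<in> carrier N" "y = g n" using lmod_epiD(2)[OF g] by blast
    then obtain d where d: "d \<in> carrier D" "h n = ?pr d"
      using lmod_homD(1)[OF h] by (auto simp: D.quotient_carrier)
    then have "d \<in> C" "\<phi> d = y" using n kh by (auto simp: C_def \<phi>_def simp flip: d(2))
    then show "y \<in> \<phi> ` C" by blast
  qed
  then have \<phi>: "\<phi> \<in> lmod_epi R ?D0 N'"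
    using \<phi>h lmod_homD(1)[OF \<phi>h] by (auto simp: lmod_epi_def)
  define K' where "K' = a_kernel ?D0 N' \<phi>"
  have "submodule K' R ?D0" unfolding K'_def by (rule submodule_a_kernel[OF D0 N' \<phi>h])
  then have K': "submodule K' R D" by (simp add: D.submodule_restrict_iff[OF C])
  have CD: "d \<in> carrier D" if "d \<in> C" for d using that by (simp add: C_def)
  \<comment> \<open>Of this equivalence, one direction lets the coset map of \<open>K'\<close>
    factor through \<open>\<phi>\<close>, giving \<open>m\<close>; the other makes \<open>m\<close>
    injective.\<close>
  have ker: "K' +>\<^bsub>D\<^esub> d = \<zero>\<^bsub>quotient_lmod D K'\<^esub> \<longleftrightarrow> \<phi> d = \<zero>\<^bsub>N'\<^esub>" if "d \<in> C" for d
    using that CD[OF that] D.coset_eq_self_iff[OF K', of d]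
    by (simp add: quotient_zero) (simp add: K'_def in_a_kernel_iff)
  note lQ' = quotient_left_module[OF D K']
  have pr': "(\<lambda>d. K' +>\<^bsub>D\<^esub> d) \<in> lmod_hom R ?D0 (quotient_lmod D K')"
    by (rule lmod_hom_comp[OF inc lmod_epiD(1)[OF coset_map_epi[OF D K']]])
  obtain m where m: "m \<in> lmod_hom R N' (quotient_lmod D K')"
    and m\<phi>: "\<And>d. d \<in> C \<Longrightarrow> m (\<phi> d) = K' +>\<^bsub>D\<^esub> d"
    using lmod_hom_factor[OF D0 N' lQ' \<phi> pr'] ker by auto
  have "inj_on m (carrier N')"
  proof (rule inj_onI)
    fix x y assume xy: "x \<in> carrier N'" "y \<in> carrier N'" "m x = m y"
    interpret Q': left_module R "quotient_lmod D K'" by (rule lQ')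
    have z: "x \<oplus>\<^bsub>N'\<^esub> (\<ominus>\<^bsub>N'\<^esub> y) \<in> carrier N'" using xy by simp
    have "\<phi> ` C = carrier N'" using lmod_epiD(2)[OF \<phi>] by simp
    with z obtain d where d: "d \<in> C" "\<phi> d = x \<oplus>\<^bsub>N'\<^esub> (\<ominus>\<^bsub>N'\<^esub> y)" by (metis imageE)
    have "m (\<phi> d) = \<zero>\<^bsub>quotient_lmod D K'\<^esub>"
      using xy lmod_homD(1,2)[OF m]
      by (simp add: d(2) lmod_hom_minus[OF N' lQ' m] Q'.r_neg)
    then have "\<phi> d = \<zero>\<^bsub>N'\<^esub>" using ker m\<phi> d(1) by simp
    then show "x = y" using d(2) xy by (simp add: N'.add_minus_eq_zero_iff)
  qed
  \<comment> \<open>The index set is still the one belonging to \<open>N\<close>, whereas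
    \<open>in_sigma\<close> for \<open>N'\<close> prescribes indices built from the type of
    \<open>N'\<close>; \<open>in_sigma_any_index\<close> bridges the two.\<close>
  then have "in_sigma_idx TYPE('n \<times> nat) R M N'"
    using m K' N' unfolding in_sigma_idx_def D_def by blast
  then show ?thesis by (rule in_sigma_any_index[OF M])
qed

subsection \<open>Trace\<close>

lemma sum_of_submodules_submodule:
  assumes V: "left_module R V" and sub: "\<And>N. N \<in> \<N> \<Longrightarrow> submodule N R V"
  shows "submodule (sum_of_submodules V \<N>) R V"
proof -
  interpret V: left_module R V by fact
  have inV: "x \<in> carrier V" if "x \<in> N" "N \<in> \<N>" for x N
    using V.submoduleD(1)[OF sub[OF that(2)]] that(1) by auto
  show ?thesis
  proof (rule V.submodule_smultI)
    show "sum_of_submodules V \<N> \<subseteq> carrier V"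
      using inV by (auto simp: sum_of_submodules_def Pi_def subset_iff intro!: V.finsum_closed)
    show "\<zero>\<^bsub>V\<^esub> \<in> sum_of_submodules V \<N>"
      unfolding sum_of_submodules_def by (intro CollectI exI[of _ "{}"] exI) simp
    show "a \<oplus>\<^bsub>V\<^esub> b \<in> sum_of_submodules V \<N>"
      if "a \<in> sum_of_submodules V \<N>" "b \<in> sum_of_submodules V \<N>" for a b
    proof -
      obtain g F where F: "finite F" "F \<subseteq> \<N>" "\<forall>N\<in>F. g N \<in> N" "a = finsum V g F"
        using \<open>a \<in> _\<close> by (auto simp: sum_of_submodules_def)
      obtain g' F' where F': "finite F'" "F' \<subseteq> \<N>" "\<forall>N\<in>F'. g' N \<in> N" "b = finsum V g' F'"
        using \<open>b \<in> _\<close> by (auto simp: sum_of_submodules_def)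
      \<comment> \<open>A sum may use each submodule only once, so the two families cannot simply be
        concatenated. Both are extended by zero to the union of their index sets and added there
        member by member.\<close>
      define e where "e = (\<lambda>N. if N \<in> F then g N else \<zero>\<^bsub>V\<^esub>)"
      define e' where "e' = (\<lambda>N. if N \<in> F' then g' N else \<zero>\<^bsub>V\<^esub>)"
      have e: "e N \<in> N" and e': "e' N \<in> N" if "N \<in> F \<union> F'" for N
        using that F F' V.submoduleD(2)[OF sub, of N] by (auto simp: e_def e'_def)
      have eV: "e N \<in> carrier V" "e' N \<in> carrier V" if "N \<in> F \<union> F'" for N
        using e[OF that] e'[OF that] inV that F(2) F'(2) by blast+
      have "a = finsum V e (F \<union> F')"
        unfolding F(4) using F(1) F'(1) eV(1) inV F(2,3)
        by (intro V.add.finprod_mono_neutral_cong_left) (auto simp: e_def subset_iff)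
      moreover have "b = finsum V e' (F \<union> F')"
        unfolding F'(4) using F(1) F'(1) eV(2) inV F'(2,3)
        by (intro V.add.finprod_mono_neutral_cong_left) (auto simp: e'_def subset_iff)
      ultimately have "a \<oplus>\<^bsub>V\<^esub> b = finsum V (\<lambda>N. e N \<oplus>\<^bsub>V\<^esub> e' N) (F \<union> F')"
        using eV by (simp add: V.finsum_addf Pi_def)
      moreover have "e N \<oplus>\<^bsub>V\<^esub> e' N \<in> N" if "N \<in> F \<union> F'" for N
        using V.submoduleD(3)[OF sub e[OF that] e'[OF that]] that F(2) F'(2) by blast
      ultimately show ?thesis
        unfolding sum_of_submodules_def using F(1,2) F'(1,2) by blast
    qed
    show "r \<odot>\<^bsub>V\<^esub> a \<in> sum_of_submodules V \<N>"
      if r: "r \<in> carrier R" and a: "a \<in> sum_of_submodules V \<N>" for r a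
    proof -
      obtain g F where F: "finite F" "F \<subseteq> \<N>" "\<forall>N\<in>F. g N \<in> N" "a = finsum V g F"
        using a by (auto simp: sum_of_submodules_def)
      have gV: "g \<in> F \<rightarrow> carrier V" using F inV by blast
      have "r \<odot>\<^bsub>V\<^esub> finsum V g F = finsum V (\<lambda>N. r \<odot>\<^bsub>V\<^esub> g N) F"
        using F(1) gV
      proof (induction F rule: finite_induct)
        case (insert N F)
        then show ?case using r by (simp add: V.smult_r_distr Pi_def)
      qed (use r in simp)
      moreover have "r \<odot>\<^bsub>V\<^esub> g N \<in> N" if "N \<in> F" for N
        using V.submoduleD(5)[OF sub r] F that by blast
      ultimately show ?thesis unfolding sum_of_submodules_def F(4) using F(1,2) by blast
    qed
  qed
qed

lemma sum_of_submodules_upper: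
  assumes V: "left_module R V" and N: "N \<in> \<N>" "submodule N R V"
  shows "N \<subseteq> sum_of_submodules V \<N>"
proof
  interpret V: left_module R V by fact
  fix x assume x: "x \<in> N"
  then have "x = finsum V (\<lambda>_. x) {N}" using V.submoduleD(1)[OF N(2)] by (subst V.finsum_insert) auto
  then show "x \<in> sum_of_submodules V \<N>"
    unfolding sum_of_submodules_def using x N(1) by blast
qed

lemma sum_of_submodules_least:
  assumes V: "left_module R V" and L: "submodule L R V" and le: "\<And>N. N \<in> \<N> \<Longrightarrow> N \<subseteq> L"
  shows "sum_of_submodules V \<N> \<subseteq> L"
proof -
  interpret V: left_module R V by fact
  note LD = V.submoduleD[OF L]
  have *: "finsum V g F \<in> L" if "finite F" "\<forall>N\<in>F. g N \<in> L" for g F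
    using that
  proof (induction F rule: finite_induct)
    case (insert N F)
    then show ?case using LD(1,3) by (subst V.finsum_insert) auto
  qed (simp add: LD)
  show ?thesis
  proof
    fix x assume "x \<in> sum_of_submodules V \<N>"
    then obtain g F where F: "finite F" "F \<subseteq> \<N>" "\<forall>N\<in>F. g N \<in> N" "x = finsum V g F"
      unfolding sum_of_submodules_def by blast
    then have "\<forall>N\<in>F. g N \<in> L" using le by blast
    with F(1) show "x \<in> L" unfolding F(4) by (rule *)
  qed
qed

subsection \<open>Codense covers\<close>

lemma codense_coverD:
  assumes "codense_cover R X Z q"
  shows "left_module R Z" and "q \<in> lmod_epi R Z X"
    and "\<lbrakk>submodule L R (Z\<lparr>carrier := a_kernel Z X q\<rparr>);
          f \<in> lmod_hom R Z (quotient_lmod (Z\<lparr>carrier := a_kernel Z X q\<rparr>) L); z \<in> carrier Z\<rbrakk>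
         \<Longrightarrow> f z = L"
  using assms by (auto simp: codense_cover_def quotient_zero)

lemma small_submodule_mono:
  assumes P: "left_module R P" and K: "small_submodule R K P"
    and H: "submodule H R P" and HK: "H \<subseteq> K"
  shows "small_submodule R H P"
proof -
  interpret P: left_module R P by fact
  have Ks: "submodule K R P" using K by (simp add: small_submodule_def)
  have "H <+>\<^bsub>P\<^esub> L \<noteq> carrier P" if L: "submodule L R P" "L \<noteq> carrier P" for L
  proof
    assume "H <+>\<^bsub>P\<^esub> L = carrier P"
    moreover have "H <+>\<^bsub>P\<^esub> L \<subseteq> K <+>\<^bsub>P\<^esub> L" using HK by (auto simp: set_add_def')
    moreover have "K <+>\<^bsub>P\<^esub> L \<subseteq> carrier P"
      using P.submoduleD(1)[OF Ks] P.submoduleD(1)[OF L(1)] by (auto simp: set_add_def')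
    ultimately show False using K L by (auto simp: small_submodule_def)
  qed
  with H show ?thesis by (simp add: small_submodule_def)
qed

text \<open>Codensity controls maps out of \<open>Z\<close>, whereas \<open>d\<close> starts at
  \<open>P\<close>. Dividing the target by the image under \<open>d\<close> of the kernel of
  \<open>h\<close> is exactly what lets \<open>d\<close> descend to \<open>Z\<close>; smallness of
  that kernel then removes the error introduced by the division.\<close>

lemma hom_to_codense_kernel_eq_zero:
  assumes P: "left_module R P" and X: "left_module R X" and Z: "codense_cover R X Z q"
    and h: "h \<in> lmod_epi R P Z" and small: "small_submodule R (a_kernel P Z h) P"
    and d: "d \<in> lmod_hom R P (Z\<lparr>carrier := a_kernel Z X q\<rparr>)" and x: "x \<in> carrier P"
  shows "d x = \<zero>\<^bsub>Z\<^esub>"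
proof -
  note lZ = codense_coverD(1)[OF Z] and hh = lmod_epiD(1)[OF h]
  interpret P: left_module R P by fact
  interpret Z: left_module R Z by fact
  let ?H = "a_kernel P Z h" and ?Q = "Z\<lparr>carrier := a_kernel Z X q\<rparr>"
  have Q: "left_module R ?Q"
    by (rule Z.submodule_left_module[OF submodule_a_kernel[OF lZ X
            lmod_epiD(1)[OF codense_coverD(2)[OF Z]]]])
  interpret Q: left_module R ?Q by fact
  have H: "submodule ?H R P" by (rule submodule_a_kernel[OF P lZ hh])
  define L where "L = d ` ?H"
  have "d \<in> lmod_hom R (P\<lparr>carrier := ?H\<rparr>) ?Q"
    using lmod_hom_comp[OF lmod_hom_inclusion[OF P.submoduleD(1)[OF H]] d] .
  from submodule_image[OF P.submodule_left_module[OF H] Q this]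
  have L: "submodule L R ?Q" by (simp add: L_def)
  note lQL = quotient_left_module[OF Q L]
  have dL: "(\<lambda>x. L +>\<^bsub>?Q\<^esub> d x) \<in> lmod_hom R P (quotient_lmod ?Q L)"
    by (rule lmod_hom_comp[OF d lmod_epiD(1)[OF coset_map_epi[OF Q L]]])
  have ker: "L +>\<^bsub>?Q\<^esub> d y = \<zero>\<^bsub>quotient_lmod ?Q L\<^esub>"
    if "y \<in> carrier P" "h y = \<zero>\<^bsub>Z\<^esub>" for y
    using that Q.coset_eq_self_iff[OF L lmod_homD(1)[OF d that(1)]]
    by (auto simp: quotient_zero L_def in_a_kernel_iff)
  obtain e where e: "e \<in> lmod_hom R Z (quotient_lmod ?Q L)"
    and eh: "\<And>y. y \<in> carrier P \<Longrightarrow> e (h y) = L +>\<^bsub>?Q\<^esub> d y"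
    using lmod_hom_factor[OF P lZ lQL h dL ker] by blast
  have dim: "d y \<in> L" if y: "y \<in> carrier P" for y
    using codense_coverD(3)[OF Z L e lmod_homD(1)[OF hh y]]
      Q.coset_eq_self_iff[OF L lmod_homD(1)[OF d y]] eh[OF y] by simp
  define D where "D = a_kernel P ?Q d"
  have D: "submodule D R P" unfolding D_def by (rule submodule_a_kernel[OF P Q d])
  \<comment> \<open>Since \<open>d y\<close> lies in \<open>L\<close>, some \<open>k\<close> in the
    kernel of \<open>h\<close> has the same image under \<open>d\<close>, and \<open>y\<close> is
    \<open>k\<close> plus an element of the kernel of \<open>d\<close>.\<close>
  have "y \<in> ?H <+>\<^bsub>P\<^esub> D" if y: "y \<in> carrier P" for y
  proof -
    obtain k where k: "k \<in> ?H" "d y = d k" using dim[OF y] by (auto simp: L_def)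
    have kP: "k \<in> carrier P" using k by (simp add: in_a_kernel_iff)
    have "d (y \<oplus>\<^bsub>P\<^esub> (\<ominus>\<^bsub>P\<^esub> k)) = \<zero>\<^bsub>?Q\<^esub>"
      using kP y k(2) lmod_homD(1)[OF d kP] Q.r_neg[of "d k"]
      by (simp only: lmod_homD(2)[OF d] lmod_hom_minus[OF P Q d] P.a_inv_closed)
    then have "y \<oplus>\<^bsub>P\<^esub> (\<ominus>\<^bsub>P\<^esub> k) \<in> D" using kP y by (simp add: D_def in_a_kernel_iff)
    moreover have "y = k \<oplus>\<^bsub>P\<^esub> (y \<oplus>\<^bsub>P\<^esub> (\<ominus>\<^bsub>P\<^esub> k))"
      using kP y by (simp add: P.a_lcomm[of k] P.r_neg)
    ultimately show ?thesis using k(1) by (auto simp: set_add_def')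
  qed
  moreover have "?H <+>\<^bsub>P\<^esub> D \<subseteq> carrier P"
    using P.submoduleD(1)[OF H] P.submoduleD(1)[OF D] by (auto simp: set_add_def')
  ultimately have "?H <+>\<^bsub>P\<^esub> D = carrier P" by blast
  with small D have "D = carrier P" by (auto simp: small_submodule_def)
  then have "x \<in> D" using x by simp
  then show ?thesis by (simp add: D_def in_a_kernel_iff)
qed

text \<open>As \<open>q\<close> already maps the image \<open>H\<close> of \<open>h\<close> onto
  \<open>X\<close>, the module \<open>Z\<close> is the sum of \<open>H\<close> and Ker q. By the
  second isomorphism theorem Z/H is then a factor module of Ker q, so codensity forces the
  projection of \<open>Z\<close> onto Z/H to vanish.\<close>

lemma lift_to_codense_cover_epi:
  assumes P: "left_module R P" and X: "left_module R X" and Z: "codense_cover R X Z q"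
    and h: "h \<in> lmod_hom R P Z" and qh: "(\<lambda>x. q (h x)) \<in> lmod_epi R P X"
  shows "h \<in> lmod_epi R P Z"
proof -
  note lZ = codense_coverD(1)[OF Z] and q = lmod_epiD(1)[OF codense_coverD(2)[OF Z]]
  interpret P: left_module R P by fact
  interpret Z: left_module R Z by fact
  interpret X: left_module R X by fact
  let ?K = "a_kernel Z X q"
  let ?Q = "Z\<lparr>carrier := ?K\<rparr>"
  have K: "submodule ?K R Z" by (rule submodule_a_kernel[OF lZ X q])
  have Q: "left_module R ?Q" by (rule Z.submodule_left_module[OF K])
  interpret Q: left_module R ?Q by fact
  define H where "H = h ` carrier P"
  have H: "submodule H R Z" unfolding H_def by (rule submodule_image[OF P lZ h])
  note HD = Z.submoduleD[OF H]
  have lZH: "left_module R (quotient_lmod Z H)" by (rule quotient_left_module[OF lZ H])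
  \<comment> \<open>The element \<open>k\<close> is \<open>z\<close> minus some \<open>h p\<close>
    with the same image under \<open>q\<close>. Equality of cosets shows that Ker q maps onto Z/H;
    the implication reduces the final claim from \<open>z\<close> to elements of Ker q.\<close>
  have decomp: "\<exists>k\<in>?K. H +>\<^bsub>Z\<^esub> k = H +>\<^bsub>Z\<^esub> z \<and> (k \<in> H \<longrightarrow> z \<in> H)" if z: "z \<in> carrier Z" for z
  proof -
    obtain p where p: "p \<in> carrier P" "q (h p) = q z"
      using lmod_epiD(2)[OF qh] lmod_homD(1)[OF q z] by (metis (no_types, lifting) imageE)
    have hp: "h p \<in> carrier Z" "h p \<in> H" using lmod_homD(1)[OF h p(1)] p by (auto simp: H_def)
    let ?k = "z \<oplus>\<^bsub>Z\<^esub> (\<ominus>\<^bsub>Z\<^esub> h p)"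
    have "?k \<in> ?K"
      using hp z p lmod_homD(1)[OF q z]
      by (simp add: in_a_kernel_iff lmod_homD(2)[OF q] lmod_hom_minus[OF lZ X q] X.r_neg)
    moreover have "?k \<oplus>\<^bsub>Z\<^esub> (\<ominus>\<^bsub>Z\<^esub> z) = \<ominus>\<^bsub>Z\<^esub> h p" using hp z
    by (simp add: Z.a_comm[of z "\<ominus>\<^bsub>Z\<^esub> h p"] Z.a_assoc Z.r_neg)
    then have "H +>\<^bsub>Z\<^esub> ?k = H +>\<^bsub>Z\<^esub> z" using hp z HD(4) by (simp add: Z.coset_eq_iff[OF H])
    moreover have "?k \<in> H \<longrightarrow> z \<in> H"
      using HD(3)[of ?k "h p"] hp z by (simp add: Z.a_assoc Z.l_neg)
    ultimately show ?thesis by blast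
  qed
  have KZ: "k \<in> carrier Z" if "k \<in> ?K" for k using that by (simp add: in_a_kernel_iff)
  have a: "(\<lambda>k. H +>\<^bsub>Z\<^esub> k) \<in> lmod_epi R ?Q (quotient_lmod Z H)"
  proof -
    have "{H +>\<^bsub>Z\<^esub> z |z. z \<in> carrier Z} = (\<lambda>k. H +>\<^bsub>Z\<^esub> k) ` ?K"
    proof (intro equalityI subsetI)
      fix c assume "c \<in> {H +>\<^bsub>Z\<^esub> z |z. z \<in> carrier Z}"
      then obtain z where z: "z \<in> carrier Z" "c = H +>\<^bsub>Z\<^esub> z" by blast
      obtain k where "k \<in> ?K" "H +>\<^bsub>Z\<^esub> k = H +>\<^bsub>Z\<^esub> z" using decomp[OF z(1)] by blast
      then show "c \<in> (\<lambda>k. H +>\<^bsub>Z\<^esub> k) ` ?K" unfolding z(2) by (metis imageI)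
    qed (use KZ in blast)
    then show ?thesis
      using lmod_hom_comp[OF lmod_hom_inclusion[OF Z.submoduleD(1)[OF K]]
          lmod_epiD(1)[OF coset_map_epi[OF lZ H]]]
      by (simp add: lmod_epi_def Z.quotient_carrier)
  qed
  define L where "L = H \<inter> ?K"
  have L: "submodule L R ?Q"
    using HD(2,3,5) Q.M.zero_closed Q.M.a_closed Q.smult_closed
    by (intro Q.submodule_smultI) (auto simp: L_def)
  have b: "(\<lambda>k. L +>\<^bsub>?Q\<^esub> k) \<in> lmod_hom R ?Q (quotient_lmod ?Q L)"
    by (rule lmod_epiD(1)[OF coset_map_epi[OF Q L]])
  have ker: "L +>\<^bsub>?Q\<^esub> k = \<zero>\<^bsub>quotient_lmod ?Q L\<^esub>"
    if "k \<in> carrier ?Q" "H +>\<^bsub>Z\<^esub> k = \<zero>\<^bsub>quotient_lmod Z H\<^esub>" for k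
    using that KZ Z.coset_eq_self_iff[OF H, of k] Q.coset_eq_self_iff[OF L that(1)]
    by (simp add: quotient_zero L_def)
  \<comment> \<open>This is the second isomorphism in the direction from Z/H to Ker q modulo
    \<open>L\<close>. Its composite with the projection from \<open>Z\<close> is zero by codensity,
    so each \<open>k\<close> in Ker q lies in \<open>L\<close> and hence in
    \<open>H\<close>.\<close>
  obtain e where e: "e \<in> lmod_hom R (quotient_lmod Z H) (quotient_lmod ?Q L)"
    and eH: "\<And>k. k \<in> ?K \<Longrightarrow> e (H +>\<^bsub>Z\<^esub> k) = L +>\<^bsub>?Q\<^esub> k"
    using lmod_hom_factor[OF Q lZH quotient_left_module[OF Q L] a b ker] by auto
  have "k \<in> H" if k: "k \<in> ?K" for k
    using codense_coverD(3)[OF Z L lmod_hom_comp[OF lmod_epiD(1)[OF coset_map_epi[OF lZ H]] e]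
        KZ[OF k]] eH[OF k] Q.coset_eq_self_iff[OF L, of k] k by (simp add: L_def)
  then have "carrier Z \<subseteq> H" using decomp by blast
  with h lmod_homD(1)[OF h] show ?thesis by (auto simp: lmod_epi_def H_def)
qed

section \<open>The cover P/T: codensity, maximality and uniqueness\<close>

theorem mainTheorem2:
  fixes R :: "'r ring"
    and M :: "('r, 'm) module"
    and X :: "('r, 'x) module"
    and P :: "('r, 'p) module"
    and \<pi> :: "'p \<Rightarrow> 'x"
    and T :: "'p set"
  assumes "ring R"
    and "left_module R M"
    and "in_sigma R M X"
    and "projective_cover R M X P \<pi>"
    and "T = lmod_trace R P (P\<lparr>carrier := a_kernel P X \<pi>\<rparr>)"
  shows "maximal_codense_cover TYPE('z) R M X (quotient_lmod P T) (induced_map \<pi>)"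
proof -
  have P_sig: "in_sigma R M P" and \<pi>: "\<pi> \<in> lmod_epi R P X"
    and small: "small_submodule R (a_kernel P X \<pi>) P" and proj: "projective_in_sigma R M P"
    using assms(4) by (auto simp: projective_cover_def projective_in_sigma_def
        projective_in_sigma_wrt_def)
  note X = in_sigma_left_module[OF assms(3)] and P = in_sigma_left_module[OF P_sig] and \<pi>h = lmod_epiD(1)[OF \<pi>]
  interpret X: left_module R X by (rule X)
  interpret P: left_module R P by (rule P)
  let ?K = "a_kernel P X \<pi>"
  let ?PK = "P\<lparr>carrier := ?K\<rparr>"
  have K: "submodule ?K R P" by (rule submodule_a_kernel[OF P X \<pi>h])
  have PK: "left_module R ?PK" by (rule P.submodule_left_module[OF K])
  interpret PK: left_module R ?PK by (rule PK)
  have T_PK: "submodule T R ?PK"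
    unfolding assms(5) lmod_trace_def
    by (rule sum_of_submodules_submodule[OF PK]) (auto intro: submodule_image[OF P PK])
  then have T: "submodule T R P" and TK: "T \<subseteq> ?K" by (simp_all add: P.submodule_restrict_iff[OF K])
  have T_upper: "g x \<in> T" if "g \<in> lmod_hom R P ?PK" "x \<in> carrier P" for g x
  proof -
    have "g ` carrier P \<in> {f ` carrier P | f. f \<in> lmod_hom R P ?PK}" using that(1) by blast
    from sum_of_submodules_upper[OF PK this submodule_image[OF P PK that(1)]]
    have "g ` carrier P \<subseteq> T" by (simp add: assms(5) lmod_trace_def)
    then show ?thesis using that(2) by blast
  qed
  let ?Y = "quotient_lmod P T" and ?p = "induced_map \<pi>"
  let ?t = "\<lambda>x. T +>\<^bsub>P\<^esub> x"
  have Y: "left_module R ?Y" by (rule quotient_left_module[OF P T])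
  interpret Y: left_module R ?Y by (rule Y)
  note t = coset_map_epi[OF P T] and th = lmod_epiD(1)[OF coset_map_epi[OF P T]]
  have Y_cases: "\<exists>x\<in>carrier P. y = ?t x" if "y \<in> carrier ?Y" for y
    using that by (auto simp: P.quotient_carrier)
  have \<pi>T: "\<pi> y = \<zero>\<^bsub>X\<^esub>" if "y \<in> carrier P" "?t y = \<zero>\<^bsub>?Y\<^esub>" for y
    using that P.coset_eq_self_iff[OF T that(1)] TK by (auto simp: quotient_zero in_a_kernel_iff)
  \<comment> \<open>Because \<open>T\<close> lies in the kernel of \<open>\<pi>\<close>, the image
    of a coset is a singleton, so \<open>the_elem\<close> in \<open>induced_map\<close> is well
    defined.\<close>
  have p: "?p (?t x) = \<pi> x" if x: "x \<in> carrier P" for x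
  proof -
    have "\<pi> y = \<pi> x" if "y \<in> ?t x" for y
    proof -
      obtain s where s: "s \<in> T" "y = s \<oplus>\<^bsub>P\<^esub> x" using \<open>y \<in> _\<close> by (auto simp: a_r_coset_def')
      then have "s \<in> carrier P" "\<pi> s = \<zero>\<^bsub>X\<^esub>" using TK by (auto simp: in_a_kernel_iff)
      then show ?thesis using s x lmod_homD(1,2)[OF \<pi>h] by simp
    qed
    moreover have "x \<in> ?t x"
      using abelian_subgroup.a_rcos_self[OF P.submodule_abelian_subgroup[OF T] x] .
    ultimately have "\<pi> ` ?t x = {\<pi> x}" by blast
    then show ?thesis by (simp add: induced_map_def)
  qed
  \<comment> \<open>Linearity is inherited from the abstract factorization \<open>k\<close> of
    \<open>\<pi>\<close>, with which \<open>induced_map \<pi>\<close> agrees on the carrier.\<close>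
  have ph: "?p \<in> lmod_hom R ?Y X"
  proof -
    obtain k where k: "k \<in> lmod_hom R ?Y X" "\<And>x. x \<in> carrier P \<Longrightarrow> k (?t x) = \<pi> x"
      using lmod_hom_factor[OF P Y X t \<pi>h \<pi>T] by blast
    have pk: "?p y = k y" if "y \<in> carrier ?Y" for y using Y_cases[OF that] p k(2) by auto
    show ?thesis by (rule lmod_homI) (simp_all add: pk lmod_homD[OF k(1)])
  qed
  have p_epi: "?p \<in> lmod_epi R ?Y X"
  proof -
    have "?p ` carrier ?Y = \<pi> ` carrier P"
      unfolding lmod_epiD(2)[OF t, symmetric] image_image by (rule image_cong) (simp_all add: p)
    with ph lmod_epiD(2)[OF \<pi>] show ?thesis by (simp add: lmod_epi_def)
  qed
  have Y_sig: "in_sigma R M ?Y" by (rule in_sigma_epi_image[OF assms(2) P_sig Y t])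
  have codense: "codense_cover R X ?Y ?p"
  proof -
    let ?K' = "a_kernel ?Y X ?p"
    let ?YK = "?Y\<lparr>carrier := ?K'\<rparr>"
    have K': "submodule ?K' R ?Y" by (rule submodule_a_kernel[OF Y X ph])
    have YK: "left_module R ?YK" by (rule Y.submodule_left_module[OF K'])
    interpret YK: left_module R ?YK by (rule YK)
    have tK: "?t \<in> lmod_epi R ?PK ?YK"
    proof -
      have "?t ` ?K = ?K'"
        using lmod_homD(1)[OF th] Y_cases p by (fastforce simp: in_a_kernel_iff)
      then show ?thesis
        using lmod_hom_restrict_codomain[OF
            lmod_hom_comp[OF lmod_hom_inclusion[OF P.submoduleD(1)[OF K]] th]]
        by (simp add: lmod_epi_def)
    qed
    have "f y = \<zero>\<^bsub>quotient_lmod ?YK L\<^esub>"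
      if L: "submodule L R ?YK" and f: "f \<in> lmod_hom R ?Y (quotient_lmod ?YK L)"
        and y: "y \<in> carrier ?Y" for L f y
    proof -
      \<comment> \<open>The composite epimorphism from Ker \<pi> through its image in P/T onto the
        factor module by \<open>L\<close>; the map \<open>f\<close>, pulled back to
        \<open>P\<close>, is lifted along it.\<close>
      note r = lmod_epi_comp[OF tK coset_map_epi[OF YK L]]
      have PK_sig: "in_sigma R M ?PK" by (rule in_sigma_submodule[OF assms(2) P_sig K])
      have Q_sig: "in_sigma R M (quotient_lmod ?YK L)"
        by (rule in_sigma_epi_image[OF assms(2) PK_sig quotient_left_module[OF YK L] r])
      \<comment> \<open>The carriers of Ker \<pi> and of the factor module do not have the types
        fixed in \<open>projective_in_sigma\<close>, hence the passage to arbitrary types.\<close>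
      obtain g where g: "g \<in> lmod_hom R P ?PK"
        and rg: "\<forall>x\<in>carrier P. L +>\<^bsub>?YK\<^esub> ?t (g x) = f (?t x)"
        using projective_in_sigma_any_type[OF assms(2) proj] PK_sig Q_sig r lmod_hom_comp[OF th f]
        unfolding projective_in_sigma_wrt_def by blast
      obtain x where x: "x \<in> carrier P" "y = ?t x" using Y_cases[OF y] by blast
      \<comment> \<open>The lifting is one of the maps that define the trace, so passing to P/T
        kills it, and \<open>f\<close> with it.\<close>
      have gT: "g x \<in> T" by (rule T_upper[OF g x(1)])
      then have "g x \<in> carrier P" using P.submoduleD(1)[OF T] by blast
      then have "?t (g x) = \<zero>\<^bsub>?YK\<^esub>" using P.coset_eq_self_iff[OF T] gT by (simp add: quotient_zero)
      then have "L +>\<^bsub>?YK\<^esub> ?t (g x) = L"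
        using YK.coset_eq_self_iff[OF L YK.zero_closed] YK.submoduleD(2)[OF L] by simp
      then show ?thesis using rg x by (simp add: quotient_zero)
    qed
    with Y p_epi show ?thesis by (simp add: codense_cover_def)
  qed
  have "\<exists>\<psi>\<in>lmod_epi R ?Y Z. (\<forall>y\<in>carrier ?Y. q (\<psi> y) = ?p y) \<and>
        (\<forall>\<psi>'\<in>lmod_epi R ?Y Z. (\<forall>y\<in>carrier ?Y. q (\<psi>' y) = ?p y) \<longrightarrow>
          (\<forall>y\<in>carrier ?Y. \<psi>' y = \<psi> y))"
    if Z_sig: "in_sigma R M Z" and cZ: "codense_cover R X Z q" for Z :: "('r, 'z) module" and q
  proof -
    note Z = codense_coverD(1)[OF cZ] and q = codense_coverD(2)[OF cZ]
    note qh = lmod_epiD(1)[OF q]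
    interpret Z: left_module R Z by (rule Z)
    obtain h where h: "h \<in> lmod_hom R P Z" and "\<forall>x\<in>carrier P. q (h x) = \<pi> x"
      using projective_in_sigma_any_type[OF assms(2) proj] Z_sig assms(3) q \<pi>h
      unfolding projective_in_sigma_wrt_def by blast
    then have qhx: "q (h x) = \<pi> x" if "x \<in> carrier P" for x using that by blast
    have "(\<lambda>x. q (h x)) \<in> lmod_epi R P X"
      using lmod_hom_comp[OF h qh] lmod_epiD(2)[OF \<pi>] qhx
      by (auto simp: lmod_epi_def cong: image_cong)
    then have h_epi: "h \<in> lmod_epi R P Z" by (rule lift_to_codense_cover_epi[OF P X cZ h])
    \<comment> \<open>Since \<open>q\<close> after \<open>h\<close> is \<open>\<pi>\<close>, the
      kernel of \<open>h\<close> inherits smallness from that of \<open>\<pi>\<close>.\<close>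
    have "a_kernel P Z h \<subseteq> ?K"
      using lmod_hom_zero[OF Z X qh] by (auto simp: in_a_kernel_iff simp flip: qhx)
    then have smallh: "small_submodule R (a_kernel P Z h) P"
      by (rule small_submodule_mono[OF P small submodule_a_kernel[OF P Z h]])
    note vanish = hom_to_codense_kernel_eq_zero[OF P X cZ h_epi smallh]
    let ?H = "a_kernel P Z h"
    \<comment> \<open>The trace is formed inside the module Ker \<pi>, so the bound for it must be a
      submodule there; this is why Ker h is intersected with Ker \<pi>.\<close>
    have "submodule (?K \<inter> ?H) R P"
      using P.submoduleD[OF K] P.submoduleD[OF submodule_a_kernel[OF P Z h]]
      by (intro P.submodule_smultI) auto
    then have KH: "submodule (?K \<inter> ?H) R ?PK" by (simp add: P.submodule_restrict_iff[OF K])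
    have "T \<subseteq> ?K \<inter> ?H"
      unfolding assms(5) lmod_trace_def
    proof (rule sum_of_submodules_least[OF PK KH])
      fix N assume "N \<in> {f ` carrier P |f. f \<in> lmod_hom R P ?PK}"
      then obtain g where g: "g \<in> lmod_hom R P ?PK" and N: "N = g ` carrier P" by blast
      have gK: "g x \<in> carrier P" "\<pi> (g x) = \<zero>\<^bsub>X\<^esub>" if "x \<in> carrier P" for x
        using lmod_homD(1)[OF g that] by (simp_all add: in_a_kernel_iff)
      have gP: "g \<in> lmod_hom R P P"
        using lmod_hom_comp[OF g lmod_hom_inclusion[OF P.submoduleD(1)[OF K]]] .
      \<comment> \<open>Here \<open>q (h (g x))\<close> equals \<open>\<pi> (g x)\<close>, which is
        zero, so \<open>h\<close> after \<open>g\<close> lands in Ker q and must vanish.\<close>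
      have "(\<lambda>x. h (g x)) \<in> lmod_hom R P (Z\<lparr>carrier := a_kernel Z X q\<rparr>)"
        by (rule lmod_hom_restrict_codomain[OF lmod_hom_comp[OF gP h]])
          (auto simp: in_a_kernel_iff qhx gK lmod_homD(1)[OF h])
      from vanish[OF this] show "N \<subseteq> ?K \<inter> ?H" using gK by (auto simp: N in_a_kernel_iff)
    qed
    then have hT: "h x = \<zero>\<^bsub>Z\<^esub>" if "x \<in> carrier P" "?t x = \<zero>\<^bsub>?Y\<^esub>" for x
      using that P.coset_eq_self_iff[OF T that(1)] by (auto simp: quotient_zero in_a_kernel_iff)
    obtain \<psi> where \<psi>: "\<psi> \<in> lmod_hom R ?Y Z" and \<psi>t: "\<And>x. x \<in> carrier P \<Longrightarrow> \<psi> (?t x) = h x"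
      using lmod_hom_factor[OF P Y Z t h hT] by blast
    have "\<psi> ` carrier ?Y = h ` carrier P"
      unfolding lmod_epiD(2)[OF t, symmetric] image_image by (rule image_cong) (simp_all add: \<psi>t)
    then have \<psi>_epi: "\<psi> \<in> lmod_epi R ?Y Z" using \<psi> lmod_epiD(2)[OF h_epi] by (simp add: lmod_epi_def)
    have q\<psi>: "q (\<psi> y) = ?p y" if "y \<in> carrier ?Y" for y
      using Y_cases[OF that] by (auto simp: p \<psi>t qhx)
    have "\<psi>' y = \<psi> y"
      if \<psi>': "\<psi>' \<in> lmod_epi R ?Y Z" and q\<psi>': "\<forall>y\<in>carrier ?Y. q (\<psi>' y) = ?p y"
        and y: "y \<in> carrier ?Y" for \<psi>' y
    proof -
      note \<psi>'h = lmod_epiD(1)[OF \<psi>']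
      note D = lmod_homD[OF \<psi>] lmod_homD[OF \<psi>'h]
      \<comment> \<open>Both maps lie over \<open>X\<close>, so their difference takes values in Ker
        q. Composed with the projection from \<open>P\<close> it becomes a map to which
        \<open>vanish\<close> applies.\<close>
      define d where "d = (\<lambda>y. \<psi>' y \<oplus>\<^bsub>Z\<^esub> (\<ominus>\<^bsub>Z\<^esub> \<psi> y))"
      have dh: "d \<in> lmod_hom R ?Y Z"
      proof (rule lmod_homI)
        show "d (x \<oplus>\<^bsub>?Y\<^esub> y) = d x \<oplus>\<^bsub>Z\<^esub> d y" if "x \<in> carrier ?Y" "y \<in> carrier ?Y" for x y
          using that by (simp add: d_def D Z.minus_add Z.a_ac)
        show "d (r \<odot>\<^bsub>?Y\<^esub> x) = r \<odot>\<^bsub>Z\<^esub> d x" if "r \<in> carrier R" "x \<in> carrier ?Y" for r x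
          using that by (simp add: d_def D Z.smult_r_distr Z.smult_r_minus)
      qed (simp add: d_def D)
      have "q (d y) = \<zero>\<^bsub>X\<^esub>" if "y \<in> carrier ?Y" for y
        using that q\<psi>' q\<psi> lmod_homD(1)[OF ph] D lmod_homD(2)[OF qh]
        by (simp add: d_def lmod_hom_minus[OF Z X qh] X.r_neg)
      then have "(\<lambda>x. d (?t x)) \<in> lmod_hom R P (Z\<lparr>carrier := a_kernel Z X q\<rparr>)"
        using lmod_homD(1)[OF th] lmod_homD(1)[OF dh]
        by (intro lmod_hom_restrict_codomain[OF lmod_hom_comp[OF th dh]])
          (auto simp: in_a_kernel_iff)
      from vanish[OF this] have "d y = \<zero>\<^bsub>Z\<^esub>" using Y_cases[OF y] by blast
      then show ?thesis using y D by (simp add: d_def Z.add_minus_eq_zero_iff)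
    qed
    with \<psi>_epi q\<psi> show ?thesis by blast
  qed
  with assms(3) Y_sig codense show ?thesis by (simp add: maximal_codense_cover_def)
qed

end
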